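(* Let $\mathcal{B}\subset\mathcal{B}(G)$ be a von Neumann algebra, $\vartheta$ an $E_0$-semigroup on $\mathcal{B}$ and $\vartheta'$ an $E_0$-semigroup on $\mathcal{B}'$. Then $\vartheta$ and $\vartheta'$ can be paired via an inner pairing if and only if there is an isomorphism (i.e. an isomorphism modulo the constant multiplier $m\equiv1$) from the product system $E^\odot$ of $\vartheta$ onto the system $F^\odot$ (intertwiner system of $\vartheta'$).
   Context: An $E_0$-semigroup on a von Neumann algebra $\mathcal{C}$ is a family $(\theta_t)_{t\ge0}$ of normal unital $*$-endomorphisms with $\theta_0=\mathrm{id}$, $\theta_{s+t}=\theta_s\circ\theta_t$. A pairing of $\vartheta$ (on $\mathcal{B}$) and $\vartheta'$ (on $\mathcal{B}'$) is a group $(\alpha_t)_{t\in\mathbb{R}}$ of $*$-automorphisms of $\mathcal{B}(G)$ with $\alpha_{-t}(b)=\vartheta_t(b)$, $\alpha_t(b')=\vartheta'_t(b')$ for $t\ge0$, $b\in\mathcal{B}$, $b'\in\mathcal{B}'$. The pairing is inner if there is a group $(U_t)_{t\in\mathbb{R}}$ of unitaries in $\mathcal{B}(G)$ ($U_0=1$, $U_{s+t}=U_sU_t$) with $\alpha_t=U_t\,\cdot\,U_t^*$. The product system $E^\odot$ of $\vartheta$: $E_t:=\mathcal{B}$ with right action by operator multiplication, inner product $\langle x,y\rangle=x^*y$, left action $b.x:=\vartheta_t(b)x$, product $(x_s,y_t)\mapsto\vartheta_t(x_s)y_t\in E_{s+t}$. The system $F^\odot$: $F_t:=\{y\in\mathcal{B}(G):\vartheta'_t(b')y=yb'\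 \forall b'\in\mathcal{B}'\}$ with left and right $\mathcal{B}$-actions by operator multiplication, inner product $y^*z$, product $(y_s,z_t)\mapsto y_sz_t$. An isomorphism from $E^\odot$ to $F^\odot$ is a family of surjective inner-product-preserving $\mathcal{B}$-bilinear maps $u_t:E_t\to F_t$ with $u_0=\mathrm{id}_{\mathcal{B}}$ and $u_{s+t}(\vartheta_t(x_s)\hat x_t)=u_s(x_s)u_t(\hat x_t)$ for all $s,t\ge0$. *)

theory Defs
  imports Complex_Main
begin

class chilbert = ab_group_add +
  fixes hscale :: "complex \<Rightarrow> 'a \<Rightarrow> 'a"
    and hinner :: "'a \<Rightarrow> 'a \<Rightarrow> complex"
  assumes hscale_add_right: "hscale a (x + y) = hscale a x + hscale a y"
    and hscale_add_left: "hscale (a + b) x = hscale a x + hscale b x"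
    and hscale_hscale: "hscale a (hscale b x) = hscale (a * b) x"
    and hscale_one: "hscale 1 x = x"
    and hinner_add_right: "hinner x (y + z) = hinner x y + hinner x z"
    and hinner_scale_right: "hinner x (hscale a y) = a * hinner x y"
    and hinner_commute: "hinner y x = cnj (hinner x y)"
    and hinner_pos: "0 \<le> Re (hinner x x)"
    and hinner_definite: "hinner x x = 0 \<Longrightarrow> x = 0"
    and hcomplete: "\<And>X :: nat \<Rightarrow> 'a.
        (\<forall>e>0. \<exists>N. \<forall>m\<ge>N. \<forall>n\<ge>N. sqrt (Re (hinner (X m - X n) (X m - X n))) < e) \<Longrightarrow>
        (\<exists>L. (\<lambda>n. sqrt (Re (hinner (X n - L) (X n - L)))) \<longlonglongrightarrow> 0)"

definition hnorm :: "'a::chilbert \<Rightarrow> real" where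
  "hnorm x = sqrt (Re (hinner x x))"

definition bounded_op :: "('a::chilbert \<Rightarrow> 'a) \<Rightarrow> bool" where
  "bounded_op A \<longleftrightarrow> (\<forall>x y. A (x + y) = A x + A y) \<and> (\<forall>c x. A (hscale c x) = hscale c (A x))
     \<and> (\<exists>K. \<forall>x. hnorm (A x) \<le> K * hnorm x)"

definition BG :: "('a::chilbert \<Rightarrow> 'a) set" where
  "BG = {A. bounded_op A}"

definition adj :: "('a::chilbert \<Rightarrow> 'a) \<Rightarrow> ('a \<Rightarrow> 'a)" where
  "adj A = (THE B. \<forall>x y. hinner (A x) y = hinner x (B y))"

definition opadd :: "('a::chilbert \<Rightarrow> 'a) \<Rightarrow> ('a \<Rightarrow> 'a) \<Rightarrow> ('a \<Rightarrow> 'a)" where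
  "opadd A B = (\<lambda>x. A x + B x)"

definition opscale :: "complex \<Rightarrow> ('a::chilbert \<Rightarrow> 'a) \<Rightarrow> ('a \<Rightarrow> 'a)" where
  "opscale c A = (\<lambda>x. hscale c (A x))"

definition commutant :: "('a::chilbert \<Rightarrow> 'a) set \<Rightarrow> ('a \<Rightarrow> 'a) set" where
  "commutant S = {T \<in> BG. \<forall>A\<in>S. T \<circ> A = A \<circ> T}"

definition von_neumann_algebra :: "('a::chilbert \<Rightarrow> 'a) set \<Rightarrow> bool" where
  "von_neumann_algebra M \<longleftrightarrow> M \<subseteq> BG \<and> (\<forall>A\<in>M. adj A \<in> M) \<and> commutant (commutant M) = M"

definition unitary_op :: "('a::chilbert \<Rightarrow> 'a) \<Rightarrow> bool" where
  "unitary_op U \<longleftrightarrow> U \<in> BG \<and> adj U \<circ> U = id \<and> U \<circ> adj U = id"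

definition self_adjoint_op :: "('a::chilbert \<Rightarrow> 'a) \<Rightarrow> bool" where
  "self_adjoint_op A \<longleftrightarrow> A \<in> BG \<and> adj A = A"

definition op_le :: "('a::chilbert \<Rightarrow> 'a) \<Rightarrow> ('a \<Rightarrow> 'a) \<Rightarrow> bool" where
  "op_le A B \<longleftrightarrow> (\<forall>x. Re (hinner x (A x)) \<le> Re (hinner x (B x)))"

definition is_op_lub :: "('a::chilbert \<Rightarrow> 'a) set \<Rightarrow> ('a \<Rightarrow> 'a) \<Rightarrow> bool" where
  "is_op_lub D x \<longleftrightarrow> self_adjoint_op x \<and> (\<forall>d\<in>D. op_le d x)
     \<and> (\<forall>y. self_adjoint_op y \<and> (\<forall>d\<in>D. op_le d y) \<longrightarrow> op_le x y)"

definition directed_up :: "('a::chilbert \<Rightarrow> 'a) set \<Rightarrow> bool" where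
  "directed_up D \<longleftrightarrow> D \<noteq> {} \<and> (\<forall>a\<in>D. \<forall>b\<in>D. \<exists>c\<in>D. op_le a c \<and> op_le b c)"

definition normal_map :: "('a::chilbert \<Rightarrow> 'a) set \<Rightarrow> (('a \<Rightarrow> 'a) \<Rightarrow> ('a \<Rightarrow> 'a)) \<Rightarrow> bool" where
  "normal_map C \<theta> \<longleftrightarrow> (\<forall>D x. D \<subseteq> C \<and> (\<forall>d\<in>D. self_adjoint_op d) \<and> directed_up D
       \<and> x \<in> C \<and> is_op_lub D x \<longrightarrow> is_op_lub (\<theta> ` D) (\<theta> x))"

definition star_endomorphism :: "('a::chilbert \<Rightarrow> 'a) set \<Rightarrow> (('a \<Rightarrow> 'a) \<Rightarrow> ('a \<Rightarrow> 'a)) \<Rightarrow> bool" where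
  "star_endomorphism C \<theta> \<longleftrightarrow> (\<forall>A\<in>C. \<theta> A \<in> C)
     \<and> (\<forall>A\<in>C. \<forall>B\<in>C. \<theta> (opadd A B) = opadd (\<theta> A) (\<theta> B))
     \<and> (\<forall>c. \<forall>A\<in>C. \<theta> (opscale c A) = opscale c (\<theta> A))
     \<and> (\<forall>A\<in>C. \<forall>B\<in>C. \<theta> (A \<circ> B) = \<theta> A \<circ> \<theta> B)
     \<and> (\<forall>A\<in>C. \<theta> (adj A) = adj (\<theta> A))
     \<and> \<theta> id = id"

definition E0_semigroup :: "('a::chilbert \<Rightarrow> 'a) set \<Rightarrow> (real \<Rightarrow> ('a \<Rightarrow> 'a) \<Rightarrow> ('a \<Rightarrow> 'a)) \<Rightarrow> bool" where
  "E0_semigroup C \<theta> \<longleftrightarrow> (\<forall>t\<ge>0. star_endomorphism C (\<theta> t) \<and> normal_map C (\<theta> t))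
     \<and> (\<forall>A\<in>C. \<theta> 0 A = A)
     \<and> (\<forall>s\<ge>0. \<forall>t\<ge>0. \<forall>A\<in>C. \<theta> (s + t) A = \<theta> s (\<theta> t A))"

definition star_automorphism :: "(('a::chilbert \<Rightarrow> 'a) \<Rightarrow> ('a \<Rightarrow> 'a)) \<Rightarrow> bool" where
  "star_automorphism \<alpha> \<longleftrightarrow> star_endomorphism BG \<alpha> \<and> bij_betw \<alpha> BG BG"

definition pairing :: "('a::chilbert \<Rightarrow> 'a) set \<Rightarrow> (real \<Rightarrow> ('a \<Rightarrow> 'a) \<Rightarrow> ('a \<Rightarrow> 'a))
    \<Rightarrow> (real \<Rightarrow> ('a \<Rightarrow> 'a) \<Rightarrow> ('a \<Rightarrow> 'a)) \<Rightarrow> (real \<Rightarrow> ('a \<Rightarrow> 'a) \<Rightarrow> ('a \<Rightarrow> 'a)) \<Rightarrow> bool" where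
  "pairing M \<theta> \<theta>' \<alpha> \<longleftrightarrow> (\<forall>t. star_automorphism (\<alpha> t))
     \<and> (\<forall>A\<in>BG. \<alpha> 0 A = A)
     \<and> (\<forall>s t. \<forall>A\<in>BG. \<alpha> (s + t) A = \<alpha> s (\<alpha> t A))
     \<and> (\<forall>t\<ge>0. \<forall>b\<in>M. \<alpha> (- t) b = \<theta> t b)
     \<and> (\<forall>t\<ge>0. \<forall>b'\<in>commutant M. \<alpha> t b' = \<theta>' t b')"

definition inner_pairing :: "(real \<Rightarrow> ('a::chilbert \<Rightarrow> 'a) \<Rightarrow> ('a \<Rightarrow> 'a)) \<Rightarrow> bool" where
  "inner_pairing \<alpha> \<longleftrightarrow> (\<exists>U :: real \<Rightarrow> ('a \<Rightarrow> 'a).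
       (\<forall>t. unitary_op (U t)) \<and> U 0 = id \<and> (\<forall>s t. U (s + t) = U s \<circ> U t)
     \<and> (\<forall>t. \<forall>A\<in>BG. \<alpha> t A = U t \<circ> A \<circ> adj (U t)))"

definition intertwiner_space :: "('a::chilbert \<Rightarrow> 'a) set \<Rightarrow> (real \<Rightarrow> ('a \<Rightarrow> 'a) \<Rightarrow> ('a \<Rightarrow> 'a))
    \<Rightarrow> real \<Rightarrow> ('a \<Rightarrow> 'a) set" where
  "intertwiner_space M \<theta>' t = {y \<in> BG. \<forall>b'\<in>commutant M. \<theta>' t b' \<circ> y = y \<circ> b'}"

text \<open>An isomorphism u from E (fibres E_t = M, left action b.x = theta_t(b) x) onto F.\<close>
definition product_system_iso :: "('a::chilbert \<Rightarrow> 'a) set \<Rightarrow> (real \<Rightarrow> ('a \<Rightarrow> 'a) \<Rightarrow> ('a \<Rightarrow> 'a))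
    \<Rightarrow> (real \<Rightarrow> ('a \<Rightarrow> 'a) \<Rightarrow> ('a \<Rightarrow> 'a)) \<Rightarrow> (real \<Rightarrow> ('a \<Rightarrow> 'a) \<Rightarrow> ('a \<Rightarrow> 'a)) \<Rightarrow> bool" where
  "product_system_iso M \<theta> \<theta>' u \<longleftrightarrow>
     (\<forall>t\<ge>0. u t ` M = intertwiner_space M \<theta>' t
        \<and> (\<forall>x\<in>M. \<forall>y\<in>M. adj (u t x) \<circ> u t y = adj x \<circ> y)
        \<and> (\<forall>x\<in>M. \<forall>y\<in>M. u t (opadd x y) = opadd (u t x) (u t y))
        \<and> (\<forall>b\<in>M. \<forall>x\<in>M. u t (\<theta> t b \<circ> x) = b \<circ> u t x)
        \<and> (\<forall>b\<in>M. \<forall>x\<in>M. u t (x \<circ> b) = u t x \<circ> b))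
   \<and> (\<forall>x\<in>M. u 0 x = x)
   \<and> (\<forall>s\<ge>0. \<forall>t\<ge>0. \<forall>x\<in>M. \<forall>y\<in>M. u (s + t) (\<theta> t x \<circ> y) = u s x \<circ> u t y)"

end

theory Submission
  imports Defs
begin

text \<open>
  An implementing unitary group yields the isomorphism \<open>u\<^sub>t x = U\<^sub>t x\<close>. Conversely, right linearity
  gives \<open>u\<^sub>t x = V\<^sub>t x\<close> with the isometry \<open>V\<^sub>t = u\<^sub>t 1\<close>, so every intertwiner in \<open>F\<^sub>t\<close> has its range in
  that of \<open>V\<^sub>t\<close>. The isometry is onto because the ranges of the intertwiners are total: for \<open>\<xi> \<noteq> 0\<close>
  the functional \<open>\<phi> b = \<langle>\<xi>, \<theta>'\<^sub>t(b) \<xi>\<rangle>\<close> on \<open>M'\<close> is normal, and a maximality argument produces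
  \<open>0 \<le> e \<le> 1\<close> in \<open>M'\<close> with \<open>\<phi>(e) \<noteq> 0\<close> such that \<open>\<phi>\<close> is dominated on \<open>[0, e]\<close> by a multiple of a vector
  functional \<open>b \<mapsto> \<langle>\<zeta>, b \<zeta>\<rangle>\<close>. As \<open>e c* c e\<close> is at most a multiple of \<open>e\<close>, the map
  \<open>c e \<zeta> \<mapsto> \<theta>'\<^sub>t(c e) \<xi>\<close> is bounded and extends to an intertwiner whose range is not orthogonal to \<open>\<xi>\<close>.
\<close>

section \<open>Inner product and norm\<close>

lemma hinner_add_left: "hinner (x + y) z = hinner x z + hinner y (z::'a::chilbert)"
  using hinner_add_right[of z x y] by (metis complex_cnj_add hinner_commute)

lemma hinner_scale_left: "hinner (hscale c x) y = cnj c * hinner x (y::'a::chilbert)"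
  using hinner_scale_right[of y c x] by (metis complex_cnj_mult hinner_commute)

lemma hinner_zero_right [simp]: "hinner x (0::'a::chilbert) = 0"
  using hinner_add_right[of x 0 0] by simp

lemma hinner_zero_left [simp]: "hinner (0::'a::chilbert) x = 0"
  using hinner_add_left[of 0 0 x] by simp

lemma hinner_minus_right: "hinner x (- y) = - hinner x (y::'a::chilbert)"
  using hinner_add_right[of x y "- y"] by (intro minus_unique[symmetric]) simp

lemma hinner_minus_left: "hinner (- x) y = - hinner x (y::'a::chilbert)"
  using hinner_add_left[of x "- x" y] by (intro minus_unique[symmetric]) simp

lemma hinner_diff_right: "hinner x (y - z) = hinner x y - hinner x (z::'a::chilbert)"
  using hinner_add_right[of x y "- z"] by (simp add: hinner_minus_right)

lemma hinner_diff_left: "hinner (x - y) z = hinner x z - hinner y (z::'a::chilbert)"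
  using hinner_add_left[of x "- y" z] by (simp add: hinner_minus_left)

lemmas hinner_simps = hinner_add_left hinner_add_right hinner_scale_left hinner_scale_right
  hinner_minus_left hinner_minus_right hinner_diff_left hinner_diff_right

lemma hscale_zero_right [simp]: "hscale c (0::'a::chilbert) = 0"
  using hscale_add_right[of c 0 0] by simp

lemma hscale_zero_left [simp]: "hscale 0 (x::'a::chilbert) = 0"
  using hscale_add_left[of 0 0 x] by simp

lemma hscale_minus_one: "hscale (- 1) (x::'a::chilbert) = - x"
  using hscale_add_left[of 1 "- 1" x] by (intro minus_unique[symmetric]) (simp add: hscale_one)

lemma Re_hinner_commute: "Re (hinner x y) = Re (hinner y (x::'a::chilbert))"
  by (subst hinner_commute) simp

lemma hnorm_power2: "(hnorm (x::'a::chilbert))\<^sup>2 = Re (hinner x x)"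
  by (simp add: hnorm_def hinner_pos)

lemma hinner_self: "hinner x x = of_real ((hnorm (x::'a::chilbert))\<^sup>2)"
proof -
  have "Im (hinner x x) = 0"
    using hinner_commute[of x x] by (metis cnj.simps(2) equal_neg_zero)
  then show ?thesis by (simp add: hnorm_power2 complex_eq_iff)
qed

lemma hnorm_nonneg [simp]: "0 \<le> hnorm (x::'a::chilbert)"
  by (simp add: hnorm_def hinner_pos)

lemma hnorm_eq_0 [simp]: "hnorm (x::'a::chilbert) = 0 \<longleftrightarrow> x = 0"
  using hinner_self[of x] hinner_definite[of x] by (auto simp: hnorm_def)

lemma hnorm_zero [simp]: "hnorm (0::'a::chilbert) = 0" by simp

lemma hnorm_scale: "hnorm (hscale c (x::'a::chilbert)) = cmod c * hnorm x"
proof -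
  have "complex_of_real ((hnorm (hscale c x))\<^sup>2) = (c * cnj c) * of_real ((hnorm x)\<^sup>2)"
    by (simp only: hinner_self[symmetric] hinner_scale_left hinner_scale_right) simp
  also have "\<dots> = of_real ((cmod c * hnorm x)\<^sup>2)"
    by (simp only: complex_norm_square[symmetric] power_mult_distrib of_real_mult)
  finally have "(hnorm (hscale c x))\<^sup>2 = (cmod c * hnorm x)\<^sup>2"
    by (simp only: of_real_eq_iff)
  then show ?thesis by simp
qed

lemma hnorm_minus [simp]: "hnorm (- x) = hnorm (x::'a::chilbert)"
  by (simp add: hnorm_def hinner_simps)

lemma hnorm_minus_commute: "hnorm (x - y) = hnorm (y - (x::'a::chilbert))"
  using hnorm_minus[of "x - y"] by simp

lemma hnorm_add_power2: "(hnorm (x + y))\<^sup>2 = (hnorm x)\<^sup>2 + (hnorm y)\<^sup>2 + 2 * Re (hinner x (y::'a::chilbert))"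
  by (simp add: hnorm_power2 hinner_simps Re_hinner_commute[of y x])

text \<open>The square norm of \<open>x\<close> minus its projection \<open>hscale (c / n) y\<close>
  onto the line of \<open>y\<close> is nonnegative; expanding it gives the inequality.\<close>

lemma Cauchy_Schwarz_hinner: "cmod (hinner x y) \<le> hnorm x * hnorm (y::'a::chilbert)"
proof (cases "y = 0")
  case False
  define c where "c = hinner y x"
  define n where "n = (hnorm y)\<^sup>2"
  have n: "n > 0" using False by (simp add: n_def)
  have c': "hinner x y = cnj c" by (simp add: c_def) (rule hinner_commute)
  have "0 \<le> Re (hinner (x - hscale (c / n) y) (x - hscale (c / n) y))" by (rule hinner_pos)
  also have "hinner (x - hscale (c / n) y) (x - hscale (c / n) y)
      = hinner x x - c / n * cnj c - cnj (c / n) * (c - c / n * of_real n)"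
    by (simp only: hinner_diff_left hinner_diff_right hinner_scale_left hinner_scale_right c'
        c_def[symmetric] hinner_self[of y] n_def[symmetric]) (simp add: algebra_simps)
  also have "\<dots> = hinner x x - c * cnj c / n" using n by simp
  also have "\<dots> = of_real ((hnorm x)\<^sup>2 - (cmod c)\<^sup>2 / n)"
    by (simp only: complex_norm_square[symmetric] hinner_self of_real_diff of_real_divide)
  finally have "(cmod c)\<^sup>2 \<le> (hnorm x)\<^sup>2 * n" using n by (simp add: field_simps)
  then have "(cmod c)\<^sup>2 \<le> (hnorm x * hnorm y)\<^sup>2" by (simp add: n_def power_mult_distrib)
  then have "cmod c \<le> hnorm x * hnorm y" by (rule power2_le_imp_le) simp
  then show ?thesis by (simp add: c')
qed simp

lemma hnorm_triangle: "hnorm (x + y) \<le> hnorm x + hnorm (y::'a::chilbert)"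
proof (rule power2_le_imp_le)
  have "Re (hinner x y) \<le> hnorm x * hnorm y"
    using Cauchy_Schwarz_hinner[of x y] complex_Re_le_cmod[of "hinner x y"] by linarith
  then show "(hnorm (x + y))\<^sup>2 \<le> (hnorm x + hnorm y)\<^sup>2"
    by (simp add: hnorm_add_power2 power2_sum)
qed simp

lemma hnorm_triangle_diff: "hnorm (x - z) \<le> hnorm (x - y) + hnorm (y - (z::'a::chilbert))"
  using hnorm_triangle[of "x - y" "y - z"] by (simp add: algebra_simps)

section \<open>Norm limits\<close>

text \<open>Convergence is reduced to a real limit, since \<open>chilbert\<close> carries no
  topology. The filter is arbitrary so that sequences and nets of operators share the same limit
  rules.\<close>

definition hlim :: "('b \<Rightarrow> 'a::chilbert) \<Rightarrow> 'a \<Rightarrow> 'b filter \<Rightarrow> bool" where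
  "hlim f L F \<longleftrightarrow> ((\<lambda>d. hnorm (f d - L)) \<longlongrightarrow> 0) F"

lemma hlim_compare:
  assumes g: "((\<lambda>d. g d) \<longlongrightarrow> 0) F" and "\<And>d. hnorm (f d - L) \<le> g d"
  shows "hlim f L F"
  unfolding hlim_def by (rule tendsto_sandwich[OF _ _ tendsto_const g]) (use assms(2) in auto)

lemma hlim_add:
  assumes "hlim f L F" "hlim g M F"
  shows "hlim (\<lambda>d. f d + g d) (L + M) F"
proof (rule hlim_compare)
  show "((\<lambda>d. hnorm (f d - L) + hnorm (g d - M)) \<longlongrightarrow> 0) F"
    using tendsto_add[OF assms[unfolded hlim_def]] by simp
  show "hnorm (f d + g d - (L + M)) \<le> hnorm (f d - L) + hnorm (g d - M)" for d
    using hnorm_triangle[of "f d - L" "g d - M"] by (simp add: algebra_simps)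
qed

lemma hlim_op:
  assumes "bounded_op A" "hlim f L F"
  shows "hlim (\<lambda>d. A (f d)) (A L) F"
proof -
  obtain K where K: "\<And>x. hnorm (A x) \<le> K * hnorm x" and add: "\<And>x y. A (x + y) = A x + A y"
    using assms(1) by (auto simp: bounded_op_def)
  show ?thesis
  proof (rule hlim_compare)
    show "((\<lambda>d. K * hnorm (f d - L)) \<longlongrightarrow> 0) F"
      using tendsto_mult_left[OF assms(2)[unfolded hlim_def], of K] by simp
    show "hnorm (A (f d) - A L) \<le> K * hnorm (f d - L)" for d
      using K[of "f d - L"] add[of "f d - L" L] by simp
  qed
qed

lemma hlim_unique:
  assumes "F \<noteq> bot" "hlim f L F" "hlim f M F"
  shows "L = (M::'a::chilbert)"
proof -
  have "((\<lambda>d. hnorm (f d - L) + hnorm (f d - M)) \<longlongrightarrow> 0) F"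
    using tendsto_add[OF assms(2,3)[unfolded hlim_def]] by simp
  then have "hnorm (L - M) \<le> 0"
    by (rule tendsto_lowerbound)
      (use hnorm_triangle_diff[of L M] hnorm_minus_commute[of L] assms(1) in auto)
  then show ?thesis using hnorm_nonneg[of "L - M"] hnorm_eq_0[of "L - M"] by simp
qed

lemma hlim_hinner_left:
  assumes "hlim f L F"
  shows "((\<lambda>d. hinner (f d) v) \<longlongrightarrow> hinner L v) F"
proof (rule LIM_zero_cancel, rule tendsto_norm_zero_cancel, rule tendsto_sandwich[OF _ _ tendsto_const])
  show "((\<lambda>d. hnorm (f d - L) * hnorm v) \<longlongrightarrow> 0) F"
    using tendsto_mult_right[OF assms[unfolded hlim_def], of "hnorm v"] by simp
  show "\<forall>\<^sub>F d in F. cmod (hinner (f d) v - hinner L v) \<le> hnorm (f d - L) * hnorm v"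
    by (simp add: Cauchy_Schwarz_hinner flip: hinner_diff_left)
qed auto

lemma hlim_hinner_right:
  assumes "hlim f L F"
  shows "((\<lambda>d. hinner v (f d)) \<longlongrightarrow> hinner v L) F"
  using tendsto_cnj[OF hlim_hinner_left[OF assms, of v]] by (simp flip: hinner_commute)

section \<open>Riesz representation and adjoints\<close>

text \<open>\<open>ortho (ortho V)\<close> plays the role of the closure of a subspace
  \<open>V\<close>, so closures never have to be formed.\<close>

definition ortho :: "'a::chilbert set \<Rightarrow> 'a set" where
  "ortho V = {x. \<forall>v\<in>V. hinner v x = 0}"

text \<open>The bound \<open>r m + r n\<close> is the shape in which Cauchy estimates arise below,
  for minimising sequences and for increasing nets.\<close>

lemma Cauchy_hlim:
  fixes X :: "nat \<Rightarrow> 'a::chilbert"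
  assumes r: "r \<longlonglongrightarrow> 0" and X: "\<And>m n. hnorm (X m - X n) \<le> r m + r n"
  obtains L where "hlim X L sequentially"
proof -
  have "\<exists>N. \<forall>m\<ge>N. \<forall>n\<ge>N. hnorm (X m - X n) < e" if "e > 0" for e
  proof -
    obtain N where "\<And>n. n \<ge> N \<Longrightarrow> \<bar>r n\<bar> < e / 2"
      using LIMSEQ_D[OF r, of "e / 2"] \<open>e > 0\<close> by auto
    then have "hnorm (X m - X n) < e" if "m \<ge> N" "n \<ge> N" for m n
      using X[of m n] that by (smt (verit) field_sum_of_halves)
    then show ?thesis by blast
  qed
  then show ?thesis
    using hcomplete[of X] that by (auto simp: hlim_def hnorm_def)
qed

text \<open>The subspace need not be closed: the minimiser of \<open>\<parallel>v\<parallel>\<^sup>2 - 2 Re (l v)\<close> is found in its closure.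
  So this one statement also covers extension by continuity and orthogonal projection.\<close>
lemma Riesz_subspace:
  fixes V :: "'a::chilbert set" and l :: "'a \<Rightarrow> complex"
  assumes V0: "0 \<in> V" and Vadd: "\<And>x y. x \<in> V \<Longrightarrow> y \<in> V \<Longrightarrow> x + y \<in> V"
    and Vscale: "\<And>c x. x \<in> V \<Longrightarrow> hscale c x \<in> V"
    and ladd: "\<And>x y. x \<in> V \<Longrightarrow> y \<in> V \<Longrightarrow> l (x + y) = l x + l y"
    and lscale: "\<And>c x. x \<in> V \<Longrightarrow> l (hscale c x) = c * l x"
    and bound: "\<And>x. x \<in> V \<Longrightarrow> cmod (l x) \<le> K * hnorm x"
  obtains w where "\<And>v. v \<in> V \<Longrightarrow> l v = hinner w v" "w \<in> ortho (ortho V)" "hnorm w \<le> \<bar>K\<bar>"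
proof -
  define J where "J v = (hnorm v)\<^sup>2 - 2 * Re (l v)" for v
  \<comment> \<open>Completing the square: \<open>J\<close> is bounded below, so its infimum
    \<open>m\<close> is a genuine one.\<close>
  have J_lower: "- K\<^sup>2 \<le> J v" if "v \<in> V" for v
  proof -
    have "Re (l v) \<le> K * hnorm v"
      using bound[OF that] complex_Re_le_cmod[of "l v"] by linarith
    moreover have "0 \<le> (hnorm v - K)\<^sup>2" by simp
    ultimately show ?thesis by (simp add: J_def power2_diff mult.commute[of K])
  qed
  define m where "m = Inf (J ` V)"
  have bdd: "bdd_below (J ` V)" using J_lower by (auto simp: bdd_below_def)
  have m: "m \<le> J v" if "v \<in> V" for v
    unfolding m_def using bdd that by (auto intro: cInf_lower)
  have "\<exists>v\<in>V. J v < m + inverse (Suc n)" for n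
    using cInf_less_iff[OF _ bdd, of "m + inverse (Suc n)"] V0 unfolding m_def[symmetric] by auto
  then obtain X where XV: "\<And>n. X n \<in> V" and XJ: "\<And>n. J (X n) < m + inverse (Suc n)"
    by metis
  \<comment> \<open>The midpoint of two near-minimisers lies in \<open>V\<close>, where
    \<open>J\<close> is at least \<open>m\<close>; the parallelogram law then forces them to be
    close.\<close>
  have "hnorm (X i - X j) \<le> sqrt (2 * inverse (Suc i)) + sqrt (2 * inverse (Suc j))" for i j
  proof -
    have half: "hscale (1/2) (X i + X j) \<in> V" using XV Vadd Vscale by simp
    have "J (hscale (1/2) (X i + X j)) = (hnorm (X i + X j))\<^sup>2 / 4 - Re (l (X i)) - Re (l (X j))"
      using XV Vadd by (simp add: J_def hnorm_scale lscale ladd power_divide field_simps)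
    moreover have "(hnorm (X i - X j))\<^sup>2 + (hnorm (X i + X j))\<^sup>2 = 2 * (hnorm (X i))\<^sup>2 + 2 * (hnorm (X j))\<^sup>2"
      using hnorm_add_power2[of "X i" "- X j"] hnorm_add_power2[of "X i" "X j"]
      by (simp add: hinner_minus_right)
    ultimately have "(hnorm (X i - X j))\<^sup>2
        = 2 * J (X i) + 2 * J (X j) - 4 * J (hscale (1/2) (X i + X j))"
      by (simp add: J_def)
    also have "\<dots> \<le> 2 * inverse (Suc i) + 2 * inverse (Suc j)"
      using m[OF half] XJ[of i] XJ[of j] by linarith
    finally have "hnorm (X i - X j) \<le> sqrt (2 * inverse (Suc i) + 2 * inverse (Suc j))"
      by (rule real_le_rsqrt)
    also have "\<dots> \<le> sqrt (2 * inverse (Suc i)) + sqrt (2 * inverse (Suc j))"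
      by (rule sqrt_add_le_add_sqrt) simp_all
    finally show ?thesis .
  qed
  moreover have "(\<lambda>n. sqrt (2 * inverse (Suc n))) \<longlonglongrightarrow> 0"
    using tendsto_real_sqrt[OF tendsto_mult_left[OF LIMSEQ_inverse_real_of_nat, of 2]] by simp
  ultimately obtain w where w: "hlim X w sequentially"
    using Cauchy_hlim by blast
  have eq: "l v = hinner w v" if v: "v \<in> V" for v
  proof (rule ccontr)
    define d where "d = hinner w v - l v"
    assume "l v \<noteq> hinner w v"
    then have d: "cmod d > 0" by (simp add: d_def)
    \<comment> \<open>First variation at the limit \<open>w\<close>: moving by
      \<open>hscale c v\<close> cannot lower \<open>J\<close> beneath its infimum. The inequality is
      taken at \<open>X n\<close>, because \<open>w\<close> may lie outside
      \<open>V\<close>.\<close>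
    have var: "0 \<le> (cmod c)\<^sup>2 * (hnorm v)\<^sup>2 + 2 * Re (c * d)" for c
    proof -
      have "- inverse (Suc n) \<le> (cmod c)\<^sup>2 * (hnorm v)\<^sup>2 + 2 * Re (c * (hinner (X n) v - l v))" for n
      proof -
        have "J (X n + hscale c v) = J (X n) + (cmod c)\<^sup>2 * (hnorm v)\<^sup>2 + 2 * Re (c * (hinner (X n) v - l v))"
          using XV Vscale v by (simp add: J_def hnorm_add_power2 ladd lscale hnorm_scale
              power_mult_distrib hinner_scale_right algebra_simps)
        then show ?thesis using m[of "X n + hscale c v"] XJ[of n] XV Vscale v Vadd by fastforce
      qed
      moreover have "(\<lambda>n. (cmod c)\<^sup>2 * (hnorm v)\<^sup>2 + 2 * Re (c * (hinner (X n) v - l v)))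
          \<longlonglongrightarrow> (cmod c)\<^sup>2 * (hnorm v)\<^sup>2 + 2 * Re (c * d)"
        unfolding d_def by (intro tendsto_intros hlim_hinner_left w)
      moreover have "(\<lambda>n. - inverse (real (Suc n))) \<longlonglongrightarrow> 0"
        using tendsto_minus[OF LIMSEQ_inverse_real_of_nat] by simp
      ultimately show ?thesis by (intro LIMSEQ_le) auto
    qed
    \<comment> \<open>For the step \<open>- s * cnj d\<close> the linear term outweighs the
      quadratic one once \<open>s\<close> is small. The summand 1 keeps the inverse meaningful for
      every \<open>v\<close>.\<close>
    define s where "s = inverse ((hnorm v)\<^sup>2 + 1)"
    have s: "s > 0" "s * (hnorm v)\<^sup>2 < 1"
      by (auto simp: s_def field_simps add_pos_nonneg add_nonneg_pos intro: add_nonneg_pos)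
    have "- of_real s * cnj d * d = of_real (- s * (cmod d)\<^sup>2)"
      by (simp only: of_real_mult of_real_minus complex_norm_square) (simp add: ac_simps)
    then have "Re (- of_real s * cnj d * d) = - s * (cmod d)\<^sup>2"
      by (simp only: Re_complex_of_real)
    then have "0 \<le> s * (cmod d)\<^sup>2 * (s * (hnorm v)\<^sup>2 - 2)"
      using var[of "- of_real s * cnj d"] s(1)
      by (simp only:) (simp add: norm_mult power_mult_distrib right_diff_distrib power2_eq_square ac_simps)
    moreover have "s * (cmod d)\<^sup>2 > 0" using s d by simp
    ultimately show False using s(2) by (simp add: zero_le_mult_iff)
  qed
  moreover have "w \<in> ortho (ortho V)"
  proof -
    have "hinner v w = 0" if "v \<in> ortho V" for v
    proof -
      have "(\<lambda>n. hinner v (X n)) \<longlonglongrightarrow> hinner v w" by (rule hlim_hinner_right[OF w])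
      moreover have "hinner v (X n) = 0" for n
        using that XV[of n] hinner_commute[of v "X n"] by (auto simp: ortho_def)
      ultimately show ?thesis using LIMSEQ_unique[of "\<lambda>n. 0" "hinner v w" 0] by simp
    qed
    then show ?thesis by (simp add: ortho_def)
  qed
  \<comment> \<open>The representation holds on \<open>V\<close> only, so it is tested at
    \<open>X n\<close> instead of \<open>w\<close> and passed to the limit.\<close>
  moreover have "hnorm w \<le> \<bar>K\<bar>"
  proof -
    have n: "(\<lambda>n. hnorm (X n - w)) \<longlonglongrightarrow> 0" using w by (simp add: hlim_def)
    have "cmod (hinner w (X n)) \<le> \<bar>K\<bar> * (hnorm (X n - w) + hnorm w)" for n
    proof -
      have "cmod (hinner w (X n)) \<le> K * hnorm (X n)" using bound eq XV by metis
      also have "\<dots> \<le> \<bar>K\<bar> * hnorm (X n)" by (simp add: mult_right_mono)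
      also have "\<dots> \<le> \<bar>K\<bar> * (hnorm (X n - w) + hnorm w)"
        using hnorm_triangle[of "X n - w" w] by (simp add: mult_left_mono)
      finally show ?thesis .
    qed
    moreover have "(\<lambda>n. cmod (hinner w (X n))) \<longlonglongrightarrow> cmod (hinner w w)"
      by (intro tendsto_intros hlim_hinner_right w)
    moreover have "(\<lambda>n. \<bar>K\<bar> * (hnorm (X n - w) + hnorm w)) \<longlonglongrightarrow> \<bar>K\<bar> * (0 + hnorm w)"
      by (intro tendsto_intros n)
    ultimately have "cmod (hinner w w) \<le> \<bar>K\<bar> * hnorm w"
      using LIMSEQ_le[of "\<lambda>n. cmod (hinner w (X n))"] by auto
    then have "hnorm w * hnorm w \<le> \<bar>K\<bar> * hnorm w"
      by (simp add: hinner_self power2_eq_square norm_mult)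
    then show ?thesis using hnorm_nonneg[of w]
      by (cases "hnorm w = 0") (auto simp: mult_le_cancel_right)
  qed
  ultimately show ?thesis using that by blast
qed

section \<open>Bounded operators and their adjoints\<close>

lemma hinner_eqI:
  assumes "\<And>x. hinner x y = hinner x (z::'a::chilbert)"
  shows "y = z"
  using assms[of "y - z"] hinner_definite[of "y - z"] by (simp add: hinner_diff_right)

lemma bounded_opD:
  assumes "bounded_op A"
  shows "A (x + y) = A x + A y" "A (hscale c x) = hscale c (A x)" "A 0 = 0" "A (- x) = - A x"
    "A (x - y) = A x - A y"
proof -
  show add: "A (x + y) = A x + A y" for x y using assms by (simp add: bounded_op_def)
  show sc: "A (hscale c x) = hscale c (A x)" for c x using assms by (simp add: bounded_op_def)
  show "A 0 = 0" using add[of 0 0] by simp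
  show m: "A (- x) = - A x" for x using sc[of "- 1" x] by (simp add: hscale_minus_one)
  show "A (x - y) = A x - A y" using add[of x "- y"] m[of y] by simp
qed

lemma bounded_op_bound:
  assumes "bounded_op A"
  obtains K where "K > 0" "\<And>x. hnorm (A x) \<le> K * hnorm x"
proof -
  obtain K where K: "\<And>x. hnorm (A x) \<le> K * hnorm x" using assms by (auto simp: bounded_op_def)
  have "hnorm (A x) \<le> (\<bar>K\<bar> + 1) * hnorm x" for x
  proof -
    have "K * hnorm x \<le> (\<bar>K\<bar> + 1) * hnorm x" by (intro mult_right_mono) auto
    then show ?thesis using K[of x] by linarith
  qed
  then show ?thesis using that[of "\<bar>K\<bar> + 1"] by simp
qed

lemma adj_eqI:
  assumes "\<And>x y. hinner (A x) y = hinner x (B y)"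
  shows "adj A = B"
  unfolding adj_def
proof (rule the_equality)
  fix C assume "\<forall>x y. hinner (A x) y = hinner x (C y)"
  then show "C = B" using assms hinner_eqI by (metis ext)
qed (use assms in auto)

text \<open>Riesz representation on the whole space supplies some adjoint \<open>B\<close>, and
  uniqueness identifies it with the description \<open>adj A\<close>.\<close>

lemma hinner_adj:
  assumes "bounded_op A"
  shows "hinner (A x) y = hinner x (adj A y)"
proof -
  obtain K where K: "K > 0" "\<And>x. hnorm (A x) \<le> K * hnorm x"
    using bounded_op_bound[OF assms] by blast
  have "\<exists>w. \<forall>x. hinner y (A x) = hinner w x" for y
  proof -
    have b: "cmod (hinner y (A x)) \<le> hnorm y * K * hnorm x" for x
      using Cauchy_Schwarz_hinner[of y "A x"] mult_left_mono[OF K(2)[of x] hnorm_nonneg[of y]]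
      by (simp add: mult.assoc)
    show ?thesis
      by (rule Riesz_subspace[of UNIV "\<lambda>x. hinner y (A x)" "hnorm y * K"])
        (use b in \<open>auto simp: bounded_opD[OF assms] hinner_simps\<close>)
  qed
  then obtain B where B: "\<And>y x. hinner y (A x) = hinner (B y) x" by metis
  have "hinner (A x) y = hinner x (B y)" for x y
    using B[of y x] by (metis hinner_commute)
  then show ?thesis using adj_eqI by metis
qed

lemma hinner_adj_left:
  assumes "bounded_op A"
  shows "hinner (adj A x) y = hinner x (A y)"
  using hinner_adj[OF assms, of y x] by (metis hinner_commute)

lemma adj_adj: "bounded_op A \<Longrightarrow> adj (adj A) = A"
  by (rule adj_eqI) (rule hinner_adj_left)

lemma bounded_op_adj:
  assumes "bounded_op A"
  shows "bounded_op (adj A)"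
proof -
  obtain K where K: "K > 0" "\<And>x. hnorm (A x) \<le> K * hnorm x"
    using bounded_op_bound[OF assms] by blast
  have "hnorm (adj A y) \<le> K * hnorm y" for y
  proof (cases "adj A y = 0")
    case False
    have "(hnorm (adj A y))\<^sup>2 = Re (hinner (A (adj A y)) y)"
      by (simp add: hnorm_power2 hinner_adj[OF assms])
    also have "\<dots> \<le> hnorm (A (adj A y)) * hnorm y"
      using Cauchy_Schwarz_hinner complex_Re_le_cmod order_trans by blast
    also have "\<dots> \<le> K * hnorm (adj A y) * hnorm y"
      by (intro mult_right_mono K) simp
    finally have "hnorm (adj A y) * hnorm (adj A y) \<le> hnorm (adj A y) * (K * hnorm y)"
      by (simp add: power2_eq_square algebra_simps)
    moreover have "hnorm (adj A y) > 0" using False by (simp add: order_less_le)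
    ultimately show ?thesis by simp
  qed (use K in simp)
  moreover have "adj A (x + y) = adj A x + adj A y" for x y
    by (rule hinner_eqI) (simp add: hinner_adj[OF assms, symmetric] hinner_simps)
  moreover have "adj A (hscale c x) = hscale c (adj A x)" for c x
    by (rule hinner_eqI) (simp add: hinner_adj[OF assms, symmetric] hinner_simps)
  ultimately show ?thesis unfolding bounded_op_def by blast
qed

lemma bounded_op_comp:
  assumes "bounded_op A" "bounded_op B"
  shows "bounded_op (A \<circ> B)"
proof -
  obtain K where K: "K > 0" "\<And>x. hnorm (A x) \<le> K * hnorm x"
    using bounded_op_bound[OF assms(1)] by blast
  obtain L where L: "L > 0" "\<And>x. hnorm (B x) \<le> L * hnorm x"
    using bounded_op_bound[OF assms(2)] by blast
  have "hnorm (A (B x)) \<le> (K * L) * hnorm x" for x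
    using order_trans[OF K(2)[of "B x"] mult_left_mono[OF L(2)[of x]]] K(1) by (simp add: mult.assoc)
  then show ?thesis
    by (auto simp: bounded_op_def[of "A \<circ> B"] bounded_opD[OF assms(1)] bounded_opD[OF assms(2)])
qed

lemma bounded_op_id: "bounded_op id"
  by (auto simp: bounded_op_def intro: exI[of _ 1])

lemma bounded_op_zero: "bounded_op (\<lambda>_. 0)"
  by (auto simp: bounded_op_def intro: exI[of _ 0])

lemma bounded_op_opscale:
  assumes "bounded_op A"
  shows "bounded_op (opscale c A)"
proof -
  obtain K where K: "K > 0" "\<And>x. hnorm (A x) \<le> K * hnorm x"
    using bounded_op_bound[OF assms] by blast
  have "hnorm (opscale c A x) \<le> (cmod c * K) * hnorm x" for x
    using mult_left_mono[OF K(2)[of x], of "cmod c"] by (simp add: opscale_def hnorm_scale mult.assoc)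
  then show ?thesis
    unfolding bounded_op_def
    by (intro conjI exI[of _ "cmod c * K"])
      (auto simp: opscale_def bounded_opD[OF assms] hscale_add_right hscale_hscale mult.commute)
qed

lemma bounded_op_opadd:
  assumes "bounded_op A" "bounded_op B"
  shows "bounded_op (opadd A B)"
proof -
  obtain K where K: "K > 0" "\<And>x. hnorm (A x) \<le> K * hnorm x"
    using bounded_op_bound[OF assms(1)] by blast
  obtain L where L: "L > 0" "\<And>x. hnorm (B x) \<le> L * hnorm x"
    using bounded_op_bound[OF assms(2)] by blast
  have "hnorm (opadd A B x) \<le> (K + L) * hnorm x" for x
    using hnorm_triangle[of "A x" "B x"] K(2)[of x] L(2)[of x] by (simp add: opadd_def algebra_simps)
  then show ?thesis
    unfolding bounded_op_def
    by (auto simp: opadd_def bounded_opD[OF assms(1)] bounded_opD[OF assms(2)] hscale_add_right)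
qed

lemma adj_comp:
  assumes "bounded_op A" "bounded_op B"
  shows "adj (A \<circ> B) = adj B \<circ> adj A"
  by (rule adj_eqI) (simp add: hinner_adj[OF assms(1)] hinner_adj[OF assms(2)])

lemma adj_id: "adj id = id"
  by (rule adj_eqI) simp

section \<open>Order and strong limits\<close>

lemma self_adjoint_op_bounded: "self_adjoint_op A \<Longrightarrow> bounded_op A"
  by (simp add: self_adjoint_op_def BG_def)

lemma self_adjoint_op_hinner: "self_adjoint_op A \<Longrightarrow> hinner (A x) y = hinner x (A y)"
  using hinner_adj[of A x y] by (simp add: self_adjoint_op_def BG_def)

lemma self_adjoint_opI:
  assumes "bounded_op A" "\<And>x y. hinner (A x) y = hinner x (A y)"
  shows "self_adjoint_op A"
  using assms adj_eqI[of A A] by (simp add: self_adjoint_op_def BG_def)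

lemma self_adjoint_op_opadd: "self_adjoint_op A \<Longrightarrow> self_adjoint_op B \<Longrightarrow> self_adjoint_op (opadd A B)"
  by (rule self_adjoint_opI)
    (simp add: self_adjoint_op_bounded bounded_op_opadd, simp add: opadd_def hinner_add_left
      hinner_add_right self_adjoint_op_hinner[of A] self_adjoint_op_hinner[of B])

abbreviation opdiff :: "('a::chilbert \<Rightarrow> 'a) \<Rightarrow> ('a \<Rightarrow> 'a) \<Rightarrow> ('a \<Rightarrow> 'a)" where
  "opdiff A B \<equiv> opadd A (opscale (- 1) B)"

lemma opdiff_apply: "opdiff A B x = A x - B x"
  by (simp add: opadd_def opscale_def hscale_minus_one)

lemma self_adjoint_opdiff: "self_adjoint_op A \<Longrightarrow> self_adjoint_op B \<Longrightarrow> self_adjoint_op (opdiff A B)"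
  by (rule self_adjoint_opI)
    (simp_all add: self_adjoint_op_bounded bounded_op_opadd bounded_op_opscale opdiff_apply
      hinner_diff_left hinner_diff_right self_adjoint_op_hinner[of A] self_adjoint_op_hinner[of B])

lemma op_le_refl [simp]: "op_le a a"
  by (simp add: op_le_def)

lemma op_le_trans: "op_le a b \<Longrightarrow> op_le b c \<Longrightarrow> op_le a c"
  unfolding op_le_def using order_trans by blast

text \<open>Polarisation: the quadratic form of the difference \<open>?d\<close> vanishes. At
  \<open>?d y + y\<close> the two cross terms coincide by self-adjointness, each being the square
  norm of \<open>?d y\<close>.\<close>

lemma op_le_antisym:
  assumes "self_adjoint_op a" "self_adjoint_op b" "op_le a b" "op_le b a"
  shows "a = b"
proof
  fix y
  let ?d = "opdiff a b"
  have sa: "self_adjoint_op ?d" using assms by (simp add: self_adjoint_opdiff)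
  have zero: "Re (hinner x (?d x)) = 0" for x
    using assms(3,4) by (simp add: op_le_def opdiff_apply hinner_diff_right order_antisym)
  have "Re (hinner (?d y + y) (?d (?d y + y))) = Re (hinner (?d y) (?d (?d y))) + Re (hinner y (?d y))
      + Re (hinner (?d y) (?d y)) + Re (hinner y (?d (?d y)))"
    by (simp add: bounded_opD[OF self_adjoint_op_bounded[OF sa]] hinner_simps)
  then have "2 * Re (hinner (?d y) (?d y)) = 0"
    unfolding self_adjoint_op_hinner[OF sa, of y "?d y", symmetric] unfolding zero by simp
  then have "?d y = 0" by (simp flip: hnorm_power2)
  then show "a y = b y" by (simp add: opdiff_apply)
qed

lemma is_op_lub_unique: "is_op_lub D x \<Longrightarrow> is_op_lub D y \<Longrightarrow> x = y"
  by (auto simp: is_op_lub_def intro: op_le_antisym)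

section \<open>The operator interval [0, 1]\<close>

definition effect :: "('a::chilbert \<Rightarrow> 'a) \<Rightarrow> bool" where
  "effect a \<longleftrightarrow> self_adjoint_op a \<and> op_le (\<lambda>_. 0) a \<and> op_le a id"

lemma effectD:
  assumes "effect a"
  shows "self_adjoint_op a" "bounded_op a" "0 \<le> Re (hinner x (a x))" "Re (hinner x (a x)) \<le> Re (hinner x x)"
    "hinner (a x) y = hinner x (a y)"
  using assms by (auto simp: effect_def op_le_def self_adjoint_op_bounded self_adjoint_op_hinner)

lemma effect_zero: "effect (\<lambda>_. 0)"
  by (auto simp: effect_def op_le_def hinner_pos bounded_op_zero intro: self_adjoint_opI)

lemma effect_id: "effect id"
  by (auto simp: effect_def op_le_def hinner_pos bounded_op_id intro: self_adjoint_opI)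

lemma effect_opdiff:
  assumes "effect a" "effect b" "op_le a b"
  shows "effect (opdiff b a)"
  unfolding effect_def
proof (intro conjI)
  show "self_adjoint_op (opdiff b a)" using assms by (simp add: effectD self_adjoint_opdiff)
  show "op_le (\<lambda>_. 0) (opdiff b a)" using assms(3) by (simp add: op_le_def opdiff_apply hinner_simps)
  show "op_le (opdiff b a) id"
    unfolding op_le_def opdiff_apply hinner_diff_right
    using effectD(3)[OF assms(1)] effectD(4)[OF assms(2)] by (smt (verit) id_apply minus_complex.sel(1))
qed

text \<open>From \<open>a - a\<^sup>2 = a (1 - a) a + (1 - a) a (1 - a)\<close>.\<close>
lemma effect_square_le:
  assumes "effect a"
  shows "(hnorm (a x))\<^sup>2 \<le> Re (hinner x (a x))"
proof -
  have "0 \<le> Re (hinner (x - a x) (a (x - a x)))" by (rule effectD(3)[OF assms])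
  moreover have "hinner x (a (a x)) = hinner (a x) (a x)" by (simp add: effectD(5)[OF assms])
  moreover have "Re (hinner (a x) (a (a x))) \<le> Re (hinner (a x) (a x))" by (rule effectD(4)[OF assms])
  ultimately show ?thesis
    by (simp add: hnorm_power2 bounded_opD[OF effectD(2)[OF assms]] hinner_simps)
qed

section \<open>Increasing nets and their strong limits\<close>

text \<open>The filter of tails of \<open>D\<close>, viewed as a net indexed by itself.\<close>

definition up_filter :: "('a::chilbert \<Rightarrow> 'a) set \<Rightarrow> ('a \<Rightarrow> 'a) filter" where
  "up_filter D = (INF d\<in>D. principal {d'\<in>D. op_le d d'})"

lemma eventually_up_filter:
  assumes "directed_up D"
  shows "eventually P (up_filter D) \<longleftrightarrow> (\<exists>d\<in>D. \<forall>d'\<in>D. op_le d d' \<longrightarrow> P d')"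
  unfolding up_filter_def
proof (subst eventually_INF_base)
  show "D \<noteq> {}" using assms by (simp add: directed_up_def)
  fix a b assume "a \<in> D" "b \<in> D"
  then obtain c where "c \<in> D" "op_le a c" "op_le b c" using assms by (auto simp: directed_up_def)
  then show "\<exists>x\<in>D. principal {d' \<in> D. op_le x d'}
      \<le> inf (principal {d' \<in> D. op_le a d'}) (principal {d' \<in> D. op_le b d'})"
    by (intro bexI[of _ c]) (auto intro: op_le_trans)
qed (auto simp: eventually_principal)

lemma up_filter_not_bot: "directed_up D \<Longrightarrow> up_filter D \<noteq> bot"
  unfolding trivial_limit_def by (auto simp: eventually_up_filter intro: op_le_refl)

lemma eventually_up_filter_mem: "directed_up D \<Longrightarrow> eventually (\<lambda>d. d \<in> D) (up_filter D)"
  by (auto simp: eventually_up_filter directed_up_def)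

definition strong_lim :: "('a::chilbert \<Rightarrow> 'a) set \<Rightarrow> ('a \<Rightarrow> 'a) \<Rightarrow> bool" where
  "strong_lim D X \<longleftrightarrow> (\<forall>x. hlim (\<lambda>d. d x) (X x) (up_filter D))"

lemma strong_lim_form:
  "strong_lim D X \<Longrightarrow> ((\<lambda>d. Re (hinner x (d x))) \<longlongrightarrow> Re (hinner x (X x))) (up_filter D)"
  by (intro tendsto_Re hlim_hinner_right) (simp add: strong_lim_def)

text \<open>For \<open>d\<close> below \<open>d'\<close> the difference is again an effect, so
  \<open>effect_square_le\<close> controls its value at \<open>x\<close> by the gap between
  \<open>g d\<close> and the supremum \<open>s\<close>. Completeness concerns sequences, so the
  limit is found along elements \<open>d n\<close> whose forms approach \<open>s\<close>. These need
  not increase and are compared through common upper bounds.\<close>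

lemma effect_net_converges:
  fixes D :: "('a::chilbert \<Rightarrow> 'a) set"
  assumes dir: "directed_up D" and eff: "\<And>d. d \<in> D \<Longrightarrow> effect d"
  shows "\<exists>L. hlim (\<lambda>d. d x) L (up_filter D)"
proof -
  define g where "g d = Re (hinner x (d x))" for d :: "'a \<Rightarrow> 'a"
  define s where "s = Sup (g ` D)"
  have bdd: "bdd_above (g ` D)"
    using effectD(4)[OF eff, of _ x] by (auto simp: bdd_above_def g_def)
  have ne: "D \<noteq> {}" using dir by (simp add: directed_up_def)
  have upper: "g d \<le> s" if "d \<in> D" for d
    unfolding s_def using bdd that by (auto intro: cSup_upper)
  have step: "hnorm (d' x - d x) \<le> sqrt (s - g d)" if "d \<in> D" "d' \<in> D" "op_le d d'" for d d'
  proof (rule real_le_rsqrt)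
    have "(hnorm (opdiff d' d x))\<^sup>2 \<le> Re (hinner x (opdiff d' d x))"
      using that eff by (intro effect_square_le effect_opdiff) auto
    also have "\<dots> \<le> s - g d" using upper[OF that(2)] by (simp add: opdiff_apply hinner_simps g_def)
    finally show "(hnorm (d' x - d x))\<^sup>2 \<le> s - g d" by (simp add: opdiff_apply)
  qed
  have "\<exists>d\<in>D. s - inverse (Suc n) < g d" for n
    using less_cSup_iff[of "g ` D" "s - inverse (Suc n)"] ne bdd unfolding s_def[symmetric] by auto
  then obtain d where d: "\<And>n. d n \<in> D" and dg: "\<And>n. s - inverse (Suc n) < g (d n)" by metis
  define r where "r n = sqrt (inverse (real (Suc n)))" for n
  have step': "hnorm (d' x - d n x) \<le> r n" if "d' \<in> D" "op_le (d n) d'" for d' n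
    using step[OF d[of n] that] dg[of n] by (smt (verit) r_def real_sqrt_le_mono)
  have r: "r \<longlonglongrightarrow> 0"
    unfolding r_def using tendsto_real_sqrt[OF LIMSEQ_inverse_real_of_nat] by simp
  have "hnorm (d m x - d n x) \<le> r m + r n" for m n
  proof -
    obtain c where "c \<in> D" "op_le (d m) c" "op_le (d n) c"
      using dir d[of m] d[of n] unfolding directed_up_def by blast
    then show ?thesis
      using step'[of c m] step'[of c n] hnorm_triangle_diff[of "d m x" "d n x" "c x"]
        hnorm_minus_commute[of "d m x" "c x"] by linarith
  qed
  then obtain L where L: "hlim (\<lambda>n. d n x) L sequentially" by (rule Cauchy_hlim[OF r])
  have "hlim (\<lambda>d. d x) L (up_filter D)"
    unfolding hlim_def
  proof (rule tendstoI)
    fix e :: real assume e: "e > 0"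
    have "(\<lambda>n. r n + hnorm (d n x - L)) \<longlonglongrightarrow> 0"
      using tendsto_add[OF r L[unfolded hlim_def]] by simp
    then obtain n where n: "r n + hnorm (d n x - L) < e"
      using order_tendstoD(2)[of _ 0 sequentially e] e by (fastforce simp: eventually_sequentially)
    have "hnorm (d' x - L) < e" if "d' \<in> D" "op_le (d n) d'" for d'
      using step'[OF that] n hnorm_triangle_diff[of "d' x" L "d n x"] by linarith
    then show "\<forall>\<^sub>F d in up_filter D. dist (hnorm (d x - L)) 0 < e"
      unfolding eventually_up_filter[OF dir] using d[of n] by auto
  qed
  then show ?thesis by blast
qed

lemma hlim_cong:
  assumes "eventually (\<lambda>d. f d = g d) F" "hlim f L F"
  shows "hlim g L F"
  using assms unfolding hlim_def by (elim Lim_transform_eventually) (auto elim: eventually_mono)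

text \<open>Vigier's theorem for nets in the operator interval \<open>[0, 1]\<close>.\<close>
lemma effect_net_strong_lim:
  fixes D :: "('a::chilbert \<Rightarrow> 'a) set"
  assumes dir: "directed_up D" and eff: "\<And>d. d \<in> D \<Longrightarrow> effect d"
  obtains X where "effect X" "strong_lim D X" "is_op_lub D X"
proof -
  let ?F = "up_filter D"
  obtain X where X: "\<And>x. hlim (\<lambda>d. d x) (X x) ?F"
    using effect_net_converges[OF assms] by metis
  then have sl: "strong_lim D X" by (simp add: strong_lim_def)
  note nb = up_filter_not_bot[OF dir]
  have ev: "eventually P ?F" if "\<And>d. effect d \<Longrightarrow> P d" for P
    using eventually_up_filter_mem[OF dir] by (rule eventually_mono) (use eff that in auto)
  have lin: "d (x + y) = d x + d y" "d (hscale c x) = hscale c (d x)" if "effect d" for d :: "'a \<Rightarrow> 'a" and x y c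
    using bounded_opD[OF effectD(2)[OF that]] by auto
  have X_add: "X (x + y) = X x + X y" for x y
  proof (rule hlim_unique[OF nb])
    show "hlim (\<lambda>d. d (x + y)) (X x + X y) ?F"
      by (rule hlim_cong[OF _ hlim_add[OF X[of x] X[of y]]], rule ev)
        (simp add: lin(1))
  qed (rule X)
  have X_scale: "X (hscale c x) = hscale c (X x)" for c x
  proof (rule hlim_unique[OF nb])
    have "hlim (\<lambda>d. hscale c (d x)) (hscale c (X x)) ?F"
      using hlim_op[OF bounded_op_opscale[OF bounded_op_id, of c] X[of x]] by (simp add: opscale_def)
    then show "hlim (\<lambda>d. d (hscale c x)) (hscale c (X x)) ?F"
      by (rule hlim_cong[rotated], intro ev)
        (simp add: lin(2))
  qed (rule X)
  have form: "0 \<le> Re (hinner x (X x))" "Re (hinner x (X x)) \<le> Re (hinner x x)" for x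
    by (rule tendsto_lowerbound[OF strong_lim_form[OF sl] _ nb], rule ev, rule effectD, assumption)
      (rule tendsto_upperbound[OF strong_lim_form[OF sl] _ nb], rule ev, rule effectD, assumption)
  have X_sa: "hinner (X x) y = hinner x (X y)" for x y
  proof (rule tendsto_unique[OF nb])
    show "((\<lambda>d. hinner (d x) y) \<longlongrightarrow> hinner (X x) y) ?F" by (rule hlim_hinner_left[OF X])
    show "((\<lambda>d. hinner (d x) y) \<longlongrightarrow> hinner x (X y)) ?F"
      by (rule Lim_transform_eventually[OF hlim_hinner_right[OF X]], rule ev) (rule effectD(5)[symmetric])
  qed
  have X_bd: "hnorm (X x) \<le> 1 * hnorm x" for x
  proof -
    have "((\<lambda>d. hnorm x + hnorm (d x - X x)) \<longlongrightarrow> hnorm x + 0) ?F"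
      using X[of x] unfolding hlim_def by (intro tendsto_intros)
    moreover have "eventually (\<lambda>d. hnorm (X x) \<le> hnorm x + hnorm (d x - X x)) ?F"
    proof (rule ev)
      fix d :: "'a \<Rightarrow> 'a" assume d: "effect d"
      have "(hnorm (d x))\<^sup>2 \<le> (hnorm x)\<^sup>2"
        using effect_square_le[OF d, of x] effectD(4)[OF d, of x] by (simp add: hnorm_power2)
      then have "hnorm (d x) \<le> hnorm x" by (rule power2_le_imp_le) simp
      then show "hnorm (X x) \<le> hnorm x + hnorm (d x - X x)"
        using hnorm_triangle_diff[of "X x" 0 "d x"] hnorm_minus_commute[of "X x" "d x"] by simp
    qed
    ultimately show ?thesis using tendsto_lowerbound nb by fastforce
  qed
  have "bounded_op X" unfolding bounded_op_def using X_add X_scale X_bd by blast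
  then have sa: "self_adjoint_op X" using X_sa by (intro self_adjoint_opI)
  then have "effect X" using form by (simp add: effect_def op_le_def)
  moreover have "op_le d X" if "d \<in> D" for d
    unfolding op_le_def
  proof
    fix x show "Re (hinner x (d x)) \<le> Re (hinner x (X x))"
      by (rule tendsto_lowerbound[OF strong_lim_form[OF sl] _ nb])
        (use that in \<open>auto simp: eventually_up_filter[OF dir] op_le_def\<close>)
  qed
  moreover have "op_le X y" if "\<forall>d\<in>D. op_le d y" for y
    unfolding op_le_def
  proof
    fix x show "Re (hinner x (X x)) \<le> Re (hinner x (y x))"
      by (rule tendsto_upperbound[OF strong_lim_form[OF sl] _ nb],
          rule eventually_mono[OF eventually_up_filter_mem[OF dir]])
        (use that in \<open>auto simp: op_le_def\<close>)
  qed
  ultimately show ?thesis using that[of X] sl sa by (auto simp: is_op_lub_def)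
qed

section \<open>Normal functionals on the commutant\<close>

text \<open>The assumptions pass from \<open>M\<close> to its commutant, and the final proof
  interprets the locale at both.\<close>

locale star_closed =
  fixes M :: "('a::chilbert \<Rightarrow> 'a) set"
  assumes M_BG: "M \<subseteq> BG" and M_adj: "A \<in> M \<Longrightarrow> adj A \<in> M"
begin

abbreviation N :: "('a \<Rightarrow> 'a) set" where "N \<equiv> commutant M"

lemma N_iff: "a \<in> N \<longleftrightarrow> bounded_op a \<and> (\<forall>A\<in>M. \<forall>x. a (A x) = A (a x))"
  by (auto simp: commutant_def BG_def fun_eq_iff)

lemma M_bounded: "A \<in> M \<Longrightarrow> bounded_op A"
  using M_BG by (auto simp: BG_def)

lemma N_bounded: "a \<in> N \<Longrightarrow> bounded_op a"
  by (simp add: N_iff)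

lemma N_id: "id \<in> N"
  by (simp add: N_iff bounded_op_id)

lemma N_zero: "(\<lambda>_. 0) \<in> N"
  using bounded_opD(3)[OF M_bounded] by (simp add: N_iff bounded_op_zero)

lemma N_opadd: "a \<in> N \<Longrightarrow> b \<in> N \<Longrightarrow> opadd a b \<in> N"
  using bounded_opD(1)[OF M_bounded] bounded_op_opadd[of a b] by (simp add: N_iff opadd_def)

lemma N_opscale: "a \<in> N \<Longrightarrow> opscale c a \<in> N"
  using bounded_opD(2)[OF M_bounded] bounded_op_opscale[of a c] by (simp add: N_iff opscale_def)

lemma N_comp: "a \<in> N \<Longrightarrow> b \<in> N \<Longrightarrow> a \<circ> b \<in> N"
  using bounded_op_comp[of a b] by (simp add: N_iff)

lemma N_adj:
  assumes "a \<in> N"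
  shows "adj a \<in> N"
proof -
  have "adj a (A x) = A (adj a x)" if A: "A \<in> M" for A x
  proof (rule hinner_eqI)
    fix z
    note adj_simps = hinner_adj[OF N_bounded[OF assms]] hinner_adj[OF M_bounded[OF A]]
      hinner_adj_left[OF N_bounded[OF assms]] hinner_adj_left[OF M_bounded[OF A]]
    have "hinner z (adj a (A x)) = hinner (adj A (a z)) x" by (simp only: adj_simps)
    also have "adj A (a z) = a (adj A z)" using M_adj[OF A] assms by (simp add: N_iff)
    also have "hinner (a (adj A z)) x = hinner z (A (adj a x))" by (simp only: adj_simps)
    finally show "hinner z (adj a (A x)) = hinner z (A (adj a x))" .
  qed
  then show ?thesis using bounded_op_adj N_bounded[OF assms] by (simp add: N_iff)
qed

text \<open>Every \<open>A\<close> in \<open>M\<close> is norm continuous, so commuting with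
  \<open>A\<close> survives pointwise limits.\<close>

lemma N_strong_lim:
  assumes D: "D \<subseteq> N" "directed_up D" and X: "bounded_op X" "strong_lim D X"
  shows "X \<in> N"
proof -
  have "X (A x) = A (X x)" if A: "A \<in> M" for A x
  proof (rule hlim_unique[OF up_filter_not_bot[OF D(2)]])
    show "hlim (\<lambda>d. d (A x)) (X (A x)) (up_filter D)" using X(2) by (simp add: strong_lim_def)
    have "hlim (\<lambda>d. A (d x)) (A (X x)) (up_filter D)"
      using X(2) by (intro hlim_op[OF M_bounded[OF A]]) (simp add: strong_lim_def)
    then show "hlim (\<lambda>d. d (A x)) (A (X x)) (up_filter D)"
      by (rule hlim_cong[rotated], intro eventually_mono[OF eventually_up_filter_mem[OF D(2)]])
        (use A D(1) N_iff in fastforce)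
  qed
  then show ?thesis using X(1) by (simp add: N_iff)
qed

text \<open>Positivity is not part of the notion, so differences of positive functionals are
  covered. The limit \<open>X\<close> is both strong limit and supremum: vector functionals use the
  former, composition with a normal map the latter.\<close>

definition normal_functional :: "(('a \<Rightarrow> 'a) \<Rightarrow> real) \<Rightarrow> bool" where
  "normal_functional f \<longleftrightarrow> (\<forall>a\<in>N. \<forall>b\<in>N. f (opadd a b) = f a + f b)
     \<and> (\<forall>D X. D \<subseteq> N \<and> directed_up D \<and> (\<forall>d\<in>D. effect d) \<and> X \<in> N \<and> strong_lim D X \<and> is_op_lub D X
          \<longrightarrow> (f \<longlongrightarrow> f X) (up_filter D))"

lemma normal_functional_lincomb:
  assumes "normal_functional f" "normal_functional g"
  shows "normal_functional (\<lambda>a. p * f a + q * g a)"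
  using assms unfolding normal_functional_def by (auto simp: algebra_simps intro!: tendsto_intros)

lemma normal_functional_vector: "normal_functional (\<lambda>a. Re (hinner x (a x)))"
  unfolding normal_functional_def
  using strong_lim_form by (auto simp: opadd_def hinner_add_right)

lemma normal_functional_zero: "normal_functional f \<Longrightarrow> f (\<lambda>_. 0) = 0"
  using N_zero unfolding normal_functional_def opadd_def by fastforce

text \<open>A Hahn decomposition by maximality. Zorn's lemma yields a maximal effect
  \<open>m\<close> below \<open>s\<close> with \<open>f m\<close> nonnegative, and \<open>e\<close>
  is the remainder of \<open>s\<close>. An effect \<open>c\<close> below \<open>e\<close> with
  \<open>f c\<close> nonnegative could be added to \<open>m\<close>, so it must be zero.\<close>

lemma exists_effect_negative_below:
  assumes f: "normal_functional f" and s: "s \<in> N" "effect s"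
  obtains e where "e \<in> N" "effect e" "op_le e s" "f e \<le> f s"
    "\<And>c. c \<in> N \<Longrightarrow> effect c \<Longrightarrow> op_le c e \<Longrightarrow> 0 \<le> f c \<Longrightarrow> c = (\<lambda>_. 0)"
proof -
  have f_add: "f (opadd a b) = f a + f b" if "a \<in> N" "b \<in> N" for a b
    using f that by (simp add: normal_functional_def)
  define A where "A = {b \<in> N. effect b \<and> op_le b s \<and> 0 \<le> f b}"
  have "\<exists>m\<in>A. \<forall>a\<in>A. op_le m a \<longrightarrow> a = m"
  proof (rule predicate_Zorn)
    show "partial_order_on A (relation_of op_le A)"
      by (rule partial_order_on_relation_ofI)
        (auto simp: A_def effect_def intro: op_le_trans op_le_antisym)
    fix C assume C: "C \<in> Chains (relation_of op_le A)"
    then have CA: "C \<subseteq> A" by (rule Chains_relation_of)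
    show "\<exists>u\<in>A. \<forall>a\<in>C. op_le a u"
    proof (cases "C = {}")
      case True
      have "(\<lambda>_. 0) \<in> A"
        using s(2) N_zero effect_zero normal_functional_zero[OF f] by (simp add: A_def effect_def)
      then show ?thesis using True by auto
    next
      case False
      have "op_le a b \<or> op_le b a" if "a \<in> C" "b \<in> C" for a b
        using C that by (auto simp: Chains_def relation_of_def)
      then have dir: "directed_up C"
        using False op_le_refl unfolding directed_up_def by metis
      have CN: "C \<subseteq> N" and eff: "\<And>d. d \<in> C \<Longrightarrow> effect d" using CA by (auto simp: A_def)
      obtain X where X: "effect X" "strong_lim C X" "is_op_lub C X"
        using effect_net_strong_lim[OF dir eff] by blast
      have XN: "X \<in> N" by (rule N_strong_lim[OF CN dir effectD(2)[OF X(1)] X(2)])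
      \<comment> \<open>Normality keeps \<open>f\<close> nonnegative at the supremum of the chain,
        which is therefore an upper bound inside \<open>A\<close>.\<close>
      have "(f \<longlongrightarrow> f X) (up_filter C)"
        using f XN X CN dir eff unfolding normal_functional_def by blast
      then have "0 \<le> f X"
        by (rule tendsto_lowerbound[OF _ _ up_filter_not_bot[OF dir]])
          (rule eventually_mono[OF eventually_up_filter_mem[OF dir]], use CA in \<open>auto simp: A_def\<close>)
      moreover have "op_le X s"
        using X(3) s(2) CA by (auto simp: is_op_lub_def A_def effect_def)
      ultimately have "X \<in> A" using XN X(1) by (simp add: A_def)
      then show ?thesis using X(3) by (auto simp: is_op_lub_def)
    qed
  qed
  then obtain m where mA: "m \<in> A" and max: "\<And>a. a \<in> A \<Longrightarrow> op_le m a \<Longrightarrow> a = m" by blast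
  have m: "m \<in> N" "effect m" "op_le m s" "0 \<le> f m" using mA by (auto simp: A_def)
  let ?e = "opdiff s m"
  have eN: "?e \<in> N" using s m by (intro N_opadd N_opscale)
  show ?thesis
  proof (rule that[of ?e])
    show "?e \<in> N" by (rule eN)
    show "effect ?e" using s m by (intro effect_opdiff)
    show "op_le ?e s" using effectD(3)[OF m(2)] by (simp add: op_le_def opdiff_apply hinner_simps)
    have "s = opadd m ?e" by (simp add: fun_eq_iff opdiff_apply) (simp add: opadd_def opscale_def hscale_minus_one)
    then show "f ?e \<le> f s" using f_add[OF m(1) eN] m(4) by simp
    fix c assume c: "c \<in> N" "effect c" "op_le c ?e" "0 \<le> f c"
    have le: "op_le (opadd m c) s"
      using c(3) by (simp add: op_le_def opdiff_apply hinner_simps opadd_def algebra_simps)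
        (simp add: opscale_def hscale_minus_one hinner_simps algebra_simps)
    have "effect (opadd m c)"
      unfolding effect_def
    proof (intro conjI)
      show "self_adjoint_op (opadd m c)" using c m by (simp add: self_adjoint_op_opadd effectD)
      show "op_le (\<lambda>_. 0) (opadd m c)"
        using effectD(3)[OF m(2)] effectD(3)[OF c(2)] by (simp add: op_le_def opadd_def hinner_simps)
      show "op_le (opadd m c) id" using le s(2) op_le_trans by (auto simp: effect_def)
    qed
    then have "opadd m c \<in> A"
      using le c m N_opadd by (simp add: A_def f_add)
    moreover have "op_le m (opadd m c)"
      using effectD(3)[OF c(2)] by (simp add: op_le_def opadd_def hinner_simps)
    ultimately have "opadd m c = m" by (rule max)
    then show "c = (\<lambda>_. 0)" by (simp add: fun_eq_iff opadd_def)
  qed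
qed

end

section \<open>Intertwiners into a normal representation\<close>

text \<open>A single time: the final proof instantiates \<open>\<theta>\<close> with
  \<open>\<theta>' t\<close>.\<close>

locale normal_endomorphism = star_closed M for M :: "('a::chilbert \<Rightarrow> 'a) set" +
  fixes \<theta> :: "('a \<Rightarrow> 'a) \<Rightarrow> ('a \<Rightarrow> 'a)"
  assumes endo: "star_endomorphism N \<theta>" and normal: "normal_map N \<theta>"
begin

lemma theta_N: "a \<in> N \<Longrightarrow> \<theta> a \<in> N"
  and theta_opadd: "a \<in> N \<Longrightarrow> b \<in> N \<Longrightarrow> \<theta> (opadd a b) = opadd (\<theta> a) (\<theta> b)"
  and theta_opscale: "a \<in> N \<Longrightarrow> \<theta> (opscale c a) = opscale c (\<theta> a)"
  and theta_comp: "a \<in> N \<Longrightarrow> b \<in> N \<Longrightarrow> \<theta> (a \<circ> b) = \<theta> a \<circ> \<theta> b"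
  and theta_adj: "a \<in> N \<Longrightarrow> \<theta> (adj a) = adj (\<theta> a)"
  and theta_id: "\<theta> id = id"
  using endo by (auto simp: star_endomorphism_def)

lemma theta_bounded: "a \<in> N \<Longrightarrow> bounded_op (\<theta> a)"
  by (simp add: theta_N N_bounded)

lemma theta_zero: "\<theta> (\<lambda>_. 0) = (\<lambda>_. 0)"
  using theta_opscale[OF N_id, of 0] by (simp add: opscale_def)

lemma theta_self_adjoint: "a \<in> N \<Longrightarrow> self_adjoint_op a \<Longrightarrow> self_adjoint_op (\<theta> a)"
  using theta_adj[of a] theta_bounded[of a] by (simp add: self_adjoint_op_def BG_def)

text \<open>Order preservation is normality applied to the two-element directed set \<open>{a, b}\<close>, so no
  square roots are needed.\<close>
lemma theta_mono:
  assumes "a \<in> N" "b \<in> N" "self_adjoint_op a" "self_adjoint_op b" "op_le a b"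
  shows "op_le (\<theta> a) (\<theta> b)"
proof -
  have "directed_up {a, b}" using assms(5) by (auto simp: directed_up_def)
  moreover have "is_op_lub {a, b} b" using assms by (auto simp: is_op_lub_def)
  ultimately have "is_op_lub (\<theta> ` {a, b}) (\<theta> b)"
    using normal[unfolded normal_map_def, rule_format, of "{a, b}" b] assms by auto
  then show ?thesis by (simp add: is_op_lub_def)
qed

lemma theta_effect:
  assumes "a \<in> N" "effect a"
  shows "effect (\<theta> a)"
  using assms theta_mono[OF N_zero assms(1)] theta_mono[OF assms(1) N_id]
    effectD(1)[OF effect_zero] effectD(1)[OF effect_id]
  by (auto simp: effect_def theta_zero theta_id theta_self_adjoint)

text \<open>Normality speaks of suprema, whereas a limit is wanted. The image net is an increasing
  net of effects, so it converges strongly to its supremum, which normality identifies as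
  \<open>\<theta> X\<close>.\<close>

lemma normal_functional_theta: "normal_functional (\<lambda>a. Re (hinner \<xi> (\<theta> a \<xi>)))"
  unfolding normal_functional_def
proof (intro conjI ballI allI impI)
  fix a b assume "a \<in> N" "b \<in> N"
  then show "Re (hinner \<xi> (\<theta> (opadd a b) \<xi>)) = Re (hinner \<xi> (\<theta> a \<xi>)) + Re (hinner \<xi> (\<theta> b \<xi>))"
    by (simp add: theta_opadd) (simp add: opadd_def hinner_add_right)
next
  fix D X assume "D \<subseteq> N \<and> directed_up D \<and> (\<forall>d\<in>D. effect d) \<and> X \<in> N \<and> strong_lim D X \<and> is_op_lub D X"
  then have DN: "D \<subseteq> N" and dir: "directed_up D" and eff: "\<And>d. d \<in> D \<Longrightarrow> effect d"
    and XN: "X \<in> N" and lub: "is_op_lub D X" by auto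
  have mono: "op_le (\<theta> a) (\<theta> b)" if "a \<in> D" "b \<in> D" "op_le a b" for a b
    using that DN eff by (intro theta_mono effectD(1)) auto
  have dir': "directed_up (\<theta> ` D)"
    using dir mono unfolding directed_up_def ball_simps bex_simps by (metis image_is_empty)
  have eff': "\<And>d. d \<in> \<theta> ` D \<Longrightarrow> effect d"
    using DN eff theta_effect by blast
  obtain Y where Y: "strong_lim (\<theta> ` D) Y" "is_op_lub (\<theta> ` D) Y"
    using effect_net_strong_lim[OF dir' eff'] by blast
  have "is_op_lub (\<theta> ` D) (\<theta> X)"
    using normal DN dir eff XN lub unfolding normal_map_def by (auto simp: effectD(1))
  then have "Y = \<theta> X" using Y(2) is_op_lub_unique by blast
  then have "((\<lambda>d. Re (hinner \<xi> (d \<xi>))) \<longlongrightarrow> Re (hinner \<xi> (\<theta> X \<xi>))) (up_filter (\<theta> ` D))"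
    using strong_lim_form[OF Y(1)] by simp
  \<comment> \<open>Monotonicity maps tails of \<open>D\<close> into tails of the image net, so the
    limit can be pulled back to \<open>D\<close>.\<close>
  moreover have "filterlim \<theta> (up_filter (\<theta> ` D)) (up_filter D)"
    unfolding filterlim_iff eventually_up_filter[OF dir] eventually_up_filter[OF dir']
    using mono by blast
  ultimately show "((\<lambda>a. Re (hinner \<xi> (\<theta> a \<xi>))) \<longlongrightarrow> Re (hinner \<xi> (\<theta> X \<xi>))) (up_filter D)"
    by (rule filterlim_compose)
qed

text \<open>The maximality argument is used twice: first to find an effect \<open>s\<close> below
  which \<open>\<phi>\<close> is faithful, then below \<open>s\<close> to find \<open>e\<close> on
  which a multiple of a vector functional dominates. Faithfulness turns \<open>e\<close> being
  nonzero into \<open>\<phi> e\<close> being nonzero.\<close>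

lemma exists_dominated_effect:
  assumes "\<xi> \<noteq> 0"
  obtains e \<zeta> \<kappa> where "e \<in> N" "effect e" "0 \<le> \<kappa>" "\<theta> e \<xi> \<noteq> 0"
    "\<And>c. c \<in> N \<Longrightarrow> effect c \<Longrightarrow> op_le c e \<Longrightarrow> Re (hinner \<xi> (\<theta> c \<xi>)) \<le> \<kappa> * Re (hinner \<zeta> (c \<zeta>))"
proof -
  define \<phi> where "\<phi> a = Re (hinner \<xi> (\<theta> a \<xi>))" for a
  have \<phi>: "normal_functional \<phi>" unfolding \<phi>_def by (rule normal_functional_theta)
  have \<phi>0: "\<phi> (\<lambda>_. 0) = 0" by (rule normal_functional_zero[OF \<phi>])
  have \<phi>_nonneg: "0 \<le> \<phi> c" if "c \<in> N" "effect c" for c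
    unfolding \<phi>_def by (rule effectD(3)[OF theta_effect[OF that]])
  have "normal_functional (\<lambda>a. - 1 * \<phi> a + 0 * \<phi> a)" by (rule normal_functional_lincomb[OF \<phi> \<phi>])
  then have neg: "normal_functional (\<lambda>a. - \<phi> a)" by simp
  \<comment> \<open>As \<open>\<phi>\<close> is nonnegative on effects, \<open>supp\<close> says
    that \<open>\<phi>\<close> vanishes at no nonzero effect below \<open>s\<close>; thus
    \<open>s\<close> replaces a support projection.\<close>
  obtain s where s: "s \<in> N" "effect s" "- \<phi> s \<le> - \<phi> id"
    and supp: "\<And>c. c \<in> N \<Longrightarrow> effect c \<Longrightarrow> op_le c s \<Longrightarrow> 0 \<le> - \<phi> c \<Longrightarrow> c = (\<lambda>_. 0)"
    using exists_effect_negative_below[OF neg N_id effect_id] by metis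
  have "\<phi> id > 0"
    using assms by (simp add: \<phi>_def theta_id flip: hnorm_power2)
  then have "s \<noteq> (\<lambda>_. 0)" using s(3) \<phi>0 by auto
  then obtain \<zeta> where "Re (hinner \<zeta> (s \<zeta>)) \<noteq> 0"
    using op_le_antisym[OF effectD(1)[OF s(2)] effectD(1)[OF effect_zero]] unfolding op_le_def
    by (metis hinner_zero_right order_refl zero_complex.sel(1))
  then have \<zeta>: "Re (hinner \<zeta> (s \<zeta>)) > 0" using effectD(3)[OF s(2), of \<zeta>] by linarith
  define \<omega> where "\<omega> a = Re (hinner \<zeta> (a \<zeta>))" for a
  have \<omega>: "normal_functional \<omega>" unfolding \<omega>_def by (rule normal_functional_vector)
  \<comment> \<open>The added 1 makes \<open>\<phi> - \<kappa> * \<omega>\<close> strictly negative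
    at \<open>s\<close>, hence also at \<open>e\<close>, which excludes that \<open>e\<close> is
    zero.\<close>
  define \<kappa> where "\<kappa> = (\<phi> s + 1) / \<omega> s"
  have \<kappa>: "0 \<le> \<kappa>" "\<phi> s < \<kappa> * \<omega> s"
    using \<zeta> \<phi>_nonneg[OF s(1,2)] by (simp_all add: \<kappa>_def \<omega>_def)
  have "normal_functional (\<lambda>a. 1 * \<phi> a + (- \<kappa>) * \<omega> a)" by (rule normal_functional_lincomb[OF \<phi> \<omega>])
  then have diff: "normal_functional (\<lambda>a. \<phi> a - \<kappa> * \<omega> a)" by simp
  obtain e where e: "e \<in> N" "effect e" "op_le e s" "\<phi> e - \<kappa> * \<omega> e \<le> \<phi> s - \<kappa> * \<omega> s"
    and below: "\<And>c. c \<in> N \<Longrightarrow> effect c \<Longrightarrow> op_le c e \<Longrightarrow> 0 \<le> \<phi> c - \<kappa> * \<omega> c \<Longrightarrow> c = (\<lambda>_. 0)"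
    using exists_effect_negative_below[OF diff s(1,2)] by metis
  have "e \<noteq> (\<lambda>_. 0)"
    using e(4) \<kappa>(2) normal_functional_zero[OF diff] by auto
  then have "\<phi> e \<noteq> 0" using supp[OF e(1-3)] by auto
  then have "\<theta> e \<xi> \<noteq> 0" by (auto simp: \<phi>_def)
  moreover have "\<phi> c \<le> \<kappa> * \<omega> c" if "c \<in> N" "effect c" "op_le c e" for c
    using below[OF that] normal_functional_zero[OF diff] by (cases "0 \<le> \<phi> c - \<kappa> * \<omega> c") auto
  ultimately show ?thesis using that[of e \<kappa> \<zeta>] e \<kappa> by (simp add: \<phi>_def \<omega>_def)
qed

text \<open>For arbitrary \<open>c\<close> put \<open>a = c \<circ> e\<close>. A small multiple
  \<open>b\<close> of \<open>adj a \<circ> a\<close> lies below the square of \<open>e\<close>,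
  hence below \<open>e\<close>, so the domination on effects applies to \<open>b\<close>. The forms
  of \<open>\<theta> b\<close> and \<open>b\<close> are square norms, and the factor
  \<open>r\<close> cancels. The witnesses are \<open>e \<zeta>\<close> and
  \<open>sqrt \<kappa>\<close>.\<close>

lemma exists_dominating_vector:
  assumes "\<xi> \<noteq> 0"
  obtains e \<eta> K where "e \<in> N" "\<theta> e \<xi> \<noteq> 0" "\<And>c. c \<in> N \<Longrightarrow> hnorm (\<theta> c (\<theta> e \<xi>)) \<le> K * hnorm (c \<eta>)"
proof -
  obtain e \<zeta> \<kappa> where e: "e \<in> N" "effect e" and \<kappa>: "0 \<le> \<kappa>" and nz: "\<theta> e \<xi> \<noteq> 0"
    and dom: "\<And>c. c \<in> N \<Longrightarrow> effect c \<Longrightarrow> op_le c e \<Longrightarrow> Re (hinner \<xi> (\<theta> c \<xi>)) \<le> \<kappa> * Re (hinner \<zeta> (c \<zeta>))"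
    using exists_dominated_effect[OF assms] by metis
  have "hnorm (\<theta> c (\<theta> e \<xi>)) \<le> sqrt \<kappa> * hnorm (c (e \<zeta>))" if c: "c \<in> N" for c
  proof -
    obtain K where K: "K > 0" "\<And>x. hnorm (c x) \<le> K * hnorm x"
      using bounded_op_bound[OF N_bounded[OF c]] by blast
    define r where "r = 1 / K\<^sup>2"
    have r: "r > 0" using K(1) by (simp add: r_def)
    define a where "a = c \<circ> e"
    have aN: "a \<in> N" unfolding a_def by (rule N_comp[OF c e(1)])
    define b where "b = opscale (of_real r) (adj a \<circ> a)"
    have bN: "b \<in> N" unfolding b_def using aN by (intro N_opscale N_comp N_adj)
    have form: "Re (hinner x (opscale (of_real r) (adj A \<circ> A) x)) = r * (hnorm (A x))\<^sup>2"
      if "bounded_op A" for A and x :: 'a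
      using hinner_adj[OF that, of x "A x", symmetric]
      by (simp add: opscale_def hinner_scale_right hinner_self)
    note b_form = form[OF N_bounded[OF aN], folded b_def]
    have "effect b" "op_le b e"
    proof -
      have le: "Re (hinner x (b x)) \<le> Re (hinner x (e x))" for x
      proof -
        have "(hnorm (a x))\<^sup>2 \<le> (K * hnorm (e x))\<^sup>2"
          unfolding a_def comp_apply by (rule power_mono[OF K(2)]) simp
        then have "r * (hnorm (a x))\<^sup>2 \<le> (hnorm (e x))\<^sup>2"
          using K(1) by (simp add: r_def field_simps power_mult_distrib)
        then show ?thesis using effect_square_le[OF e(2), of x] by (simp add: b_form)
      qed
      then show "op_le b e" by (simp add: op_le_def)
      have "self_adjoint_op b"
      proof (rule self_adjoint_opI[OF N_bounded[OF bN]])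
        fix x y
        show "hinner (b x) y = hinner x (b y)"
          using hinner_adj[OF N_bounded[OF aN], of x "a y"] hinner_adj_left[OF N_bounded[OF aN], of "a x" y]
          by (simp add: b_def opscale_def hinner_scale_left hinner_scale_right)
      qed
      moreover have "op_le (\<lambda>_. 0) b" using r by (simp add: op_le_def b_form)
      moreover have "op_le b id" using \<open>op_le b e\<close> e(2) op_le_trans by (auto simp: effect_def)
      ultimately show "effect b" by (simp add: effect_def)
    qed
    then have "Re (hinner \<xi> (\<theta> b \<xi>)) \<le> \<kappa> * Re (hinner \<zeta> (b \<zeta>))" by (intro dom bN)
    moreover have "\<theta> b = opscale (of_real r) (adj (\<theta> a) \<circ> \<theta> a)"
      using aN by (simp add: b_def theta_opscale theta_comp theta_adj N_comp N_adj)
    ultimately have "r * (hnorm (\<theta> a \<xi>))\<^sup>2 \<le> r * (\<kappa> * (hnorm (a \<zeta>))\<^sup>2)"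
      by (simp add: form[OF theta_bounded[OF aN]] b_form algebra_simps)
    then have "(hnorm (\<theta> a \<xi>))\<^sup>2 \<le> (sqrt \<kappa> * hnorm (a \<zeta>))\<^sup>2"
      using r \<kappa> by (simp add: power_mult_distrib)
    then have "hnorm (\<theta> a \<xi>) \<le> sqrt \<kappa> * hnorm (a \<zeta>)"
      by (rule power2_le_imp_le) (simp add: \<kappa>)
    then show ?thesis by (simp add: a_def theta_comp[OF c e(1)])
  qed
  then show ?thesis using that[of e "sqrt \<kappa>" "e \<zeta>"] e(1) nz by blast
qed

text \<open>Dominating the vector functional of \<open>\<theta> e \<xi>\<close> makes \<open>c \<eta> \<mapsto> \<theta> c (\<theta> e \<xi>)\<close> a bounded map on
  \<open>N \<eta>\<close>; \<open>S\<close> is the adjoint of its extension by \<open>0\<close>.\<close>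
lemma exists_intertwiner:
  assumes "\<xi> \<noteq> 0"
  obtains S where "bounded_op S" "\<And>b. b \<in> N \<Longrightarrow> S \<circ> \<theta> b = b \<circ> S" "S \<xi> \<noteq> 0"
proof -
  obtain e \<eta> K where e: "e \<in> N" and nz: "\<theta> e \<xi> \<noteq> 0"
    and dom: "\<And>c. c \<in> N \<Longrightarrow> hnorm (\<theta> c (\<theta> e \<xi>)) \<le> K * hnorm (c \<eta>)"
    using exists_dominating_vector[OF assms] by metis
  define \<rho> where "\<rho> = \<theta> e \<xi>"
  define V where "V = {c \<eta> | c. c \<in> N}"
  have VI: "c \<eta> \<in> V" if "c \<in> N" for c using that by (auto simp: V_def)
  \<comment> \<open>A representative is chosen by \<open>SOME\<close>; \<open>dom\<close> at the
    difference of two representatives shows that the choice is immaterial.\<close>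
  define T where "T v = \<theta> (SOME c. c \<in> N \<and> c \<eta> = v) \<rho>" for v
  have T: "T (c \<eta>) = \<theta> c \<rho>" if c: "c \<in> N" for c
  proof -
    define c' where "c' = (SOME c'. c' \<in> N \<and> c' \<eta> = c \<eta>)"
    have c': "c' \<in> N \<and> c' \<eta> = c \<eta>" unfolding c'_def by (rule someI[of _ c]) (simp add: c)
    have "hnorm (\<theta> (opdiff c' c) \<rho>) \<le> K * hnorm (opdiff c' c \<eta>)"
      unfolding \<rho>_def using c c' by (intro dom N_opadd N_opscale) auto
    then have "hnorm (\<theta> (opdiff c' c) \<rho>) = 0"
      using c' hnorm_nonneg[of "\<theta> (opdiff c' c) \<rho>"] by (simp add: opdiff_apply)
    moreover have "\<theta> (opdiff c' c) = opdiff (\<theta> c') (\<theta> c)"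
      using c c' by (simp add: theta_opadd theta_opscale N_opscale)
    ultimately show ?thesis unfolding T_def c'_def[symmetric] by (simp add: opdiff_apply)
  qed
  have Vadd: "x + y \<in> V" if "x \<in> V" "y \<in> V" for x y
    using that N_opadd unfolding V_def opadd_def by fastforce
  have Vscale: "hscale r x \<in> V" if "x \<in> V" for r x
    using that N_opscale unfolding V_def opscale_def by fastforce
  have Tadd: "T (x + y) = T x + T y" if xy: "x \<in> V" "y \<in> V" for x y
  proof -
    obtain a b where ab: "a \<in> N" "b \<in> N" "x = a \<eta>" "y = b \<eta>" using xy by (auto simp: V_def)
    show ?thesis
      using T[OF N_opadd[OF ab(1,2)]] ab by (simp add: T theta_opadd) (simp add: opadd_def)
  qed
  have Tscale: "T (hscale r x) = hscale r (T x)" if x: "x \<in> V" for r x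
  proof -
    obtain a where a: "a \<in> N" "x = a \<eta>" using x by (auto simp: V_def)
    show ?thesis
      using T[OF N_opscale[OF a(1), of r]] a by (simp add: T theta_opscale) (simp add: opscale_def)
  qed
  have Tbound: "hnorm (T x) \<le> K * hnorm x" if "x \<in> V" for x
    using that dom T by (auto simp: V_def \<rho>_def)
  \<comment> \<open>Riesz representation for each \<open>y\<close> gives the value of
    \<open>S\<close> at \<open>y\<close>. Placing it in \<open>ortho (ortho V)\<close> makes it
    unique, and linearity and the intertwining relation follow from uniqueness.\<close>
  have "\<exists>w. (\<forall>v\<in>V. hinner y (T v) = hinner w v) \<and> w \<in> ortho (ortho V) \<and> hnorm w \<le> \<bar>K\<bar> * hnorm y" for y
  proof (rule Riesz_subspace[of V "\<lambda>v. hinner y (T v)" "hnorm y * K"])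
    show "0 \<in> V" using VI[OF N_zero] by simp
    show "cmod (hinner y (T x)) \<le> hnorm y * K * hnorm x" if "x \<in> V" for x
      using order_trans[OF Cauchy_Schwarz_hinner mult_left_mono[OF Tbound[OF that]]]
      by (simp add: mult.assoc)
    show ?thesis if "\<And>v. v \<in> V \<Longrightarrow> hinner y (T v) = hinner w v" "w \<in> ortho (ortho V)"
      "hnorm w \<le> \<bar>hnorm y * K\<bar>" for w
      using that by (intro exI[of _ w]) (simp add: abs_mult mult.commute)
  qed (simp_all add: Vadd Vscale Tadd Tscale hinner_add_right hinner_scale_right)
  then obtain S where S_eq: "\<And>y v. v \<in> V \<Longrightarrow> hinner y (T v) = hinner (S y) v"
    and S_ortho: "\<And>y. S y \<in> ortho (ortho V)" and S_bound: "\<And>y. hnorm (S y) \<le> \<bar>K\<bar> * hnorm y"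
    by metis
  \<comment> \<open>The difference \<open>w - z\<close> lies in \<open>ortho V\<close> and is
    orthogonal to all of \<open>ortho V\<close>, hence to itself.\<close>
  have uniq: "w = z" if "w \<in> ortho (ortho V)" "z \<in> ortho (ortho V)" "\<And>v. v \<in> V \<Longrightarrow> hinner w v = hinner z v" for w z
  proof -
    have "hinner v (w - z) = 0" if "v \<in> V" for v
      using \<open>\<And>v. v \<in> V \<Longrightarrow> hinner w v = hinner z v\<close>[OF that] hinner_commute[of v "w - z"]
      by (simp add: hinner_diff_left)
    then have "w - z \<in> ortho V" by (simp add: ortho_def)
    then have "hinner (w - z) w = 0" "hinner (w - z) z = 0" using that(1,2) by (simp_all add: ortho_def)
    then have "hinner (w - z) (w - z) = 0" by (simp add: hinner_diff_right)
    then show ?thesis using hinner_definite by fastforce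
  qed
  have S_add: "S (x + y) = S x + S y" for x y
  proof (rule uniq[OF S_ortho])
    show "S x + S y \<in> ortho (ortho V)"
      using S_ortho[of x] S_ortho[of y] by (simp add: ortho_def hinner_add_right)
  qed (simp add: S_eq[symmetric] hinner_add_left)
  have S_scale: "S (hscale r x) = hscale r (S x)" for r x
  proof (rule uniq[OF S_ortho])
    show "hscale r (S x) \<in> ortho (ortho V)"
      using S_ortho[of x] by (simp add: ortho_def hinner_scale_right)
  qed (simp add: S_eq[symmetric] hinner_scale_left)
  have S_theta: "S (\<theta> b y) = b (S y)" if b: "b \<in> N" for b y
  proof (rule uniq[OF S_ortho])
    \<comment> \<open>Since \<open>b\<close> maps \<open>V\<close> into itself, \<open>adj b\<close>
      preserves \<open>ortho V\<close>, and so \<open>b\<close> preserves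
      \<open>ortho (ortho V)\<close>.\<close>
    have "adj b v \<in> ortho V" if "v \<in> ortho V" for v
    proof -
      have "hinner (c \<eta>) (adj b v) = 0" if c: "c \<in> N" for c
      proof -
        have "b (c \<eta>) \<in> V" using VI[OF N_comp[OF b c]] by simp
        then show ?thesis
          using \<open>v \<in> ortho V\<close> hinner_adj[OF N_bounded[OF b], of "c \<eta>" v] by (simp add: ortho_def)
      qed
      then show ?thesis by (auto simp: ortho_def V_def)
    qed
    then have "hinner v (b (S y)) = 0" if "v \<in> ortho V" for v
      using S_ortho[of y] that hinner_adj_left[OF N_bounded[OF b], of v "S y"] by (simp add: ortho_def)
    then show "b (S y) \<in> ortho (ortho V)" by (simp add: ortho_def)
    fix v assume "v \<in> V"
    then obtain c where c: "c \<in> N" "v = c \<eta>" by (auto simp: V_def)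
    have bc: "adj b \<circ> c \<in> N" using b c N_adj N_comp by blast
    then have bcV: "adj b (c \<eta>) \<in> V" using VI by fastforce
    have "hinner (S (\<theta> b y)) v = hinner (\<theta> b y) (\<theta> c \<rho>)"
      using S_eq[OF \<open>v \<in> V\<close>, of "\<theta> b y"] T[OF c(1)] c(2) by simp
    also have "\<dots> = hinner y (\<theta> (adj b \<circ> c) \<rho>)"
      using hinner_adj[OF theta_bounded[OF b], of y "\<theta> c \<rho>"] b c
      by (simp add: theta_comp theta_adj N_adj)
    also have "\<dots> = hinner (S y) (adj b (c \<eta>))"
      using S_eq[OF bcV, of y] T[OF bc] by simp
    also have "\<dots> = hinner (b (S y)) v"
      using hinner_adj[OF N_bounded[OF b], of "S y" "c \<eta>"] c(2) by simp
    finally show "hinner (S (\<theta> b y)) v = hinner (b (S y)) v" .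
  qed
  have "bounded_op S" unfolding bounded_op_def using S_add S_scale S_bound by blast
  moreover have "S \<circ> \<theta> b = b \<circ> S" if "b \<in> N" for b using S_theta[OF that] by auto
  \<comment> \<open>\<open>S \<rho>\<close> equals \<open>e (S \<xi>)\<close>, and its inner product
    with \<open>\<eta>\<close> is that of \<open>\<rho>\<close> with
    \<open>T \<eta> = \<rho>\<close>, which is nonzero.\<close>
  moreover have "S \<xi> \<noteq> 0"
  proof
    assume "S \<xi> = 0"
    then have "S \<rho> = 0" using S_theta[OF e, of \<xi>] bounded_opD(3)[OF N_bounded[OF e]] by (simp add: \<rho>_def)
    moreover have "\<eta> \<in> V" using VI[OF N_id] by simp
    ultimately have "hinner \<rho> \<rho> = 0"
      using S_eq[of \<eta> \<rho>] T[OF N_id] by (simp add: theta_id)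
    then show False using nz hinner_definite by (auto simp: \<rho>_def)
  qed
  ultimately show ?thesis by (rule that)
qed

end

section \<open>Unitary groups and inner pairings\<close>

lemma unitary_opD:
  assumes "unitary_op U"
  shows "bounded_op U" "bounded_op (adj U)" "adj U (U x) = x" "U (adj U x) = x"
  using assms bounded_op_adj by (auto simp: unitary_op_def BG_def fun_eq_iff)

lemma unitary_op_adj: "unitary_op U \<Longrightarrow> unitary_op (adj U)"
  using adj_adj[of U] bounded_op_adj[of U] by (auto simp: unitary_op_def BG_def)

lemma star_automorphism_conjugation:
  assumes U: "unitary_op U" and \<alpha>: "\<And>A. A \<in> BG \<Longrightarrow> \<alpha> A = U \<circ> A \<circ> adj U"
  shows "star_automorphism \<alpha>"
proof -
  note Ub = unitary_opD[OF U]
  have BG: "U \<circ> A \<circ> adj U \<in> BG" "adj U \<circ> A \<circ> U \<in> BG" if "A \<in> BG" for A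
    using that Ub by (simp_all add: BG_def bounded_op_comp)
  have "star_endomorphism BG \<alpha>"
    unfolding star_endomorphism_def
  proof (intro conjI ballI allI)
    fix A B :: "'a \<Rightarrow> 'a" and c assume A: "A \<in> BG"
    show "\<alpha> A \<in> BG" using A BG by (simp add: \<alpha>)
    have "opscale c A \<in> BG" using A by (simp add: BG_def bounded_op_opscale)
    then show "\<alpha> (opscale c A) = opscale c (\<alpha> A)"
      using A by (simp add: \<alpha> fun_eq_iff) (simp add: opscale_def bounded_opD[OF Ub(1)])
    have "adj A \<in> BG" using A by (simp add: BG_def bounded_op_adj)
    then show "\<alpha> (adj A) = adj (\<alpha> A)"
      using A Ub by (simp add: \<alpha> BG_def adj_comp adj_adj bounded_op_comp o_assoc)
    assume B: "B \<in> BG"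
    have "opadd A B \<in> BG" using A B by (simp add: BG_def bounded_op_opadd)
    then show "\<alpha> (opadd A B) = opadd (\<alpha> A) (\<alpha> B)"
      using A B by (simp add: \<alpha> fun_eq_iff) (simp add: opadd_def bounded_opD[OF Ub(1)])
    have "A \<circ> B \<in> BG" using A B by (simp add: BG_def bounded_op_comp)
    then show "\<alpha> (A \<circ> B) = \<alpha> A \<circ> \<alpha> B"
      using A B by (simp add: \<alpha> fun_eq_iff Ub)
  next
    show "\<alpha> id = id" using \<alpha>[of id] by (simp add: BG_def bounded_op_id fun_eq_iff Ub)
  qed
  moreover have "bij_betw \<alpha> BG BG"
    by (rule bij_betw_byWitness[where f' = "\<lambda>A. adj U \<circ> A \<circ> U"])
      (use BG in \<open>auto simp: \<alpha> fun_eq_iff Ub\<close>)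
  ultimately show ?thesis by (simp add: star_automorphism_def)
qed

section \<open>From a unitary semigroup to a unitary group\<close>

definition extend_adj :: "(real \<Rightarrow> 'a::chilbert \<Rightarrow> 'a) \<Rightarrow> real \<Rightarrow> 'a \<Rightarrow> 'a" where
  "extend_adj V t = (if 0 \<le> t then V t else adj (V (- t)))"

lemma extend_adj_minus: "V 0 = id \<Longrightarrow> 0 \<le> t \<Longrightarrow> extend_adj V (- t) = adj (V t)"
  by (simp add: extend_adj_def adj_id)

text \<open>In the cases of mixed sign, the largest of the absolute values of \<open>s\<close>,
  \<open>t\<close> and \<open>s + t\<close> is the sum of the other two. The semigroup law splits
  the operator at that time, and a unitary cancels against its adjoint.\<close>

lemma extend_adj_add:
  assumes U: "\<And>t. 0 \<le> t \<Longrightarrow> unitary_op (V t)"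
    and add: "\<And>s t. 0 \<le> s \<Longrightarrow> 0 \<le> t \<Longrightarrow> V (s + t) = V s \<circ> V t"
  shows "extend_adj V (s + t) = extend_adj V s \<circ> extend_adj V t"
proof -
  note D = unitary_opD[OF U]
  have adj_add: "adj (V (p + q)) = adj (V q) \<circ> adj (V p)" if "0 \<le> p" "0 \<le> q" for p q
    using that by (simp add: add adj_comp D)
  consider "0 \<le> s" "0 \<le> t" | "s < 0" "t < 0" | "0 \<le> s" "t < 0" "0 \<le> s + t"
    | "0 \<le> s" "t < 0" "s + t < 0" | "s < 0" "0 \<le> t" "0 \<le> s + t" | "s < 0" "0 \<le> t" "s + t < 0"
    by linarith
  then show ?thesis
  proof cases
    case 1
    then show ?thesis by (simp add: extend_adj_def add)
  next
    case 2
    then show ?thesis using adj_add[of "- t" "- s"] by (simp add: extend_adj_def add.commute)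
  next
    case 3
    then show ?thesis
      using add[of "s + t" "- t"] D(4)[of "- t"] by (simp add: extend_adj_def fun_eq_iff)
  next
    case 4
    then show ?thesis
      using adj_add[of "- (s + t)" s] D(4)[of s] by (simp add: extend_adj_def fun_eq_iff)
  next
    case 5
    then show ?thesis
      using add[of "- s" "s + t"] D(3)[of "- s"] by (simp add: extend_adj_def fun_eq_iff)
  next
    case 6
    then show ?thesis
      using adj_add[of t "- (s + t)"] D(3)[of t] by (simp add: extend_adj_def fun_eq_iff)
  qed
qed

section \<open>Passing between inner pairings and isomorphisms of product systems\<close>

theorem theorem3p1:
  fixes M :: "('a::chilbert \<Rightarrow> 'a) set"
    and \<theta> \<theta>' :: "real \<Rightarrow> ('a \<Rightarrow> 'a) \<Rightarrow> ('a \<Rightarrow> 'a)"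
  assumes "von_neumann_algebra M"
    and "E0_semigroup M \<theta>"
    and "E0_semigroup (commutant M) \<theta>'"
  shows "(\<exists>\<alpha>. pairing M \<theta> \<theta>' \<alpha> \<and> inner_pairing \<alpha>) \<longleftrightarrow> (\<exists>u. product_system_iso M \<theta> \<theta>' u)"
proof
  interpret star_closed M
    using assms(1) by unfold_locales (auto simp: von_neumann_algebra_def)
  have bicomm: "commutant N = M" using assms(1) by (simp add: von_neumann_algebra_def)
  \<comment> \<open>As \<open>M\<close> is the commutant of \<open>N\<close>, this interpretation
    yields the membership test \<open>M_iff\<close> by commutation with \<open>N\<close>.\<close>
  interpret N: star_closed N
    by unfold_locales (auto simp: N_adj BG_def N_bounded)
  note M_id = N.N_id[unfolded bicomm] and M_iff = N.N_iff[unfolded bicomm]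
  have \<theta>M: "\<theta> t b \<in> M" if "0 \<le> t" "b \<in> M" for t b
    using assms(2) that by (auto simp: E0_semigroup_def star_endomorphism_def)
  {
    assume "\<exists>\<alpha>. pairing M \<theta> \<theta>' \<alpha> \<and> inner_pairing \<alpha>"
    then obtain \<alpha> U where pair: "pairing M \<theta> \<theta>' \<alpha>"
      and U: "\<And>t. unitary_op (U t)" "U 0 = id" "\<And>s t. U (s + t) = U s \<circ> U t"
      and \<alpha>: "\<And>t A. A \<in> BG \<Longrightarrow> \<alpha> t A = U t \<circ> A \<circ> adj (U t)"
      unfolding inner_pairing_def by metis
    note D = unitary_opD[OF U(1)]
    have adjU: "adj (U t) = U (- t)" for t
    proof
      fix x
      have "U t (U (- t) x) = x" using U(3)[of t "- t"] U(2) by (simp add: fun_eq_iff)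
      then show "adj (U t) x = U (- t) x" using D(3)[of t "U (- t) x"] by simp
    qed
    have \<theta>: "\<theta> t b x = adj (U t) (b (U t x))" if "0 \<le> t" "b \<in> M" for t b x
    proof -
      have "\<theta> t b = \<alpha> (- t) b" using pair that by (simp add: pairing_def)
      also have "\<dots> = U (- t) \<circ> b \<circ> adj (U (- t))" using that M_BG by (intro \<alpha>) auto
      finally show ?thesis using adjU[of "- t"] adjU[of t] by simp
    qed
    have \<theta>': "\<theta>' t b x = U t (b (adj (U t) x))" if "0 \<le> t" "b \<in> N" for t b x
    proof -
      have "\<theta>' t b = \<alpha> t b" using pair that by (simp add: pairing_def)
      also have "\<dots> = U t \<circ> b \<circ> adj (U t)" using that N_bounded by (intro \<alpha>) (auto simp: BG_def)
      finally show ?thesis by simp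
    qed
    have "product_system_iso M \<theta> \<theta>' (\<lambda>t x. U t \<circ> x)"
      unfolding product_system_iso_def
    proof (intro conjI allI impI ballI)
      fix t :: real assume t: "0 \<le> t"
      show "(\<circ>) (U t) ` M = intertwiner_space M \<theta>' t"
      proof (intro equalityI subsetI)
        fix y assume "y \<in> (\<circ>) (U t) ` M"
        then obtain x where x: "x \<in> M" "y = U t \<circ> x" by auto
        then have "y \<in> BG" using D(1) M_bounded by (simp add: BG_def bounded_op_comp)
        moreover have "\<theta>' t b \<circ> y = y \<circ> b" if "b \<in> N" for b
          using x that by (simp add: fun_eq_iff \<theta>'[OF t that] D N_iff)
        ultimately show "y \<in> intertwiner_space M \<theta>' t" by (simp add: intertwiner_space_def)
      next
        fix y assume "y \<in> intertwiner_space M \<theta>' t"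
        then have y: "bounded_op y" "\<And>b z. b \<in> N \<Longrightarrow> \<theta>' t b (y z) = y (b z)"
          by (auto simp: intertwiner_space_def BG_def fun_eq_iff)
        \<comment> \<open>\<open>U t\<close> implements \<open>\<theta>' t\<close>, so removing it
          from an intertwiner leaves an operator commuting with \<open>N\<close>, that is, an
          element of the bicommutant \<open>M\<close>.\<close>
        have "adj (U t) \<circ> y \<in> M"
          using y(1) y(2)[symmetric] by (simp add: M_iff bounded_op_comp D \<theta>'[OF t])
        moreover have "y = U t \<circ> (adj (U t) \<circ> y)" by (simp add: fun_eq_iff D)
        ultimately show "y \<in> (\<circ>) (U t) ` M" by blast
      qed
      fix x y assume xy: "x \<in> M" "y \<in> M"
      show "adj (U t \<circ> x) \<circ> (U t \<circ> y) = adj x \<circ> y"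
        using xy by (simp add: adj_comp D M_bounded fun_eq_iff)
      show "U t \<circ> opadd x y = opadd (U t \<circ> x) (U t \<circ> y)"
        by (simp add: fun_eq_iff opadd_def bounded_opD[OF D(1)])
      show "U t \<circ> (\<theta> t x \<circ> y) = x \<circ> (U t \<circ> y)"
        using t xy by (simp add: fun_eq_iff \<theta> D)
      show "U t \<circ> (x \<circ> y) = U t \<circ> x \<circ> y" by (simp add: o_assoc)
    next
      fix x show "U 0 \<circ> x = x" by (simp add: U)
    next
      fix s t :: real and x y assume "0 \<le> s" "0 \<le> t" "x \<in> M" "y \<in> M"
      then show "U (s + t) \<circ> (\<theta> t x \<circ> y) = U s \<circ> x \<circ> (U t \<circ> y)"
        by (simp add: U fun_eq_iff \<theta> D)
    qed
    then show "\<exists>u. product_system_iso M \<theta> \<theta>' u" by blast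
  }
  {
    assume "\<exists>u. product_system_iso M \<theta> \<theta>' u"
    then obtain u where iso: "product_system_iso M \<theta> \<theta>' u" by blast
    define V where "V t = u t id" for t
    have u: "u t x = V t \<circ> x" if "0 \<le> t" "x \<in> M" for t x
    proof -
      have "u t (id \<circ> x) = u t id \<circ> x" using iso that M_id unfolding product_system_iso_def by blast
      then show ?thesis by (simp add: V_def)
    qed
    have image: "intertwiner_space M \<theta>' t = {V t \<circ> x | x. x \<in> M}" if "0 \<le> t" for t
    proof -
      have "intertwiner_space M \<theta>' t = u t ` M" using iso that by (simp add: product_system_iso_def)
      then show ?thesis using u[OF that] by auto
    qed
    have V_mem: "V t \<in> intertwiner_space M \<theta>' t" if "0 \<le> t" for t
      using image[OF that] M_id by force
    have Vb: "bounded_op (V t)" if "0 \<le> t" for t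
      using V_mem[OF that] by (simp add: intertwiner_space_def BG_def)
    have V_N: "\<theta>' t b (V t x) = V t (b x)" if "0 \<le> t" "b \<in> N" for t b x
      using V_mem[OF that(1)] that(2) by (simp add: intertwiner_space_def fun_eq_iff)
    have V_M: "V t (\<theta> t b x) = b (V t x)" if "0 \<le> t" "b \<in> M" for t b x
    proof -
      have "u t (\<theta> t b \<circ> id) = b \<circ> u t id" using iso that M_id unfolding product_system_iso_def by blast
      then show ?thesis using u[OF that(1) \<theta>M[OF that]] by (simp add: V_def fun_eq_iff)
    qed
    have isometry: "adj (V t) (V t x) = x" if "0 \<le> t" for t x
    proof -
      have "adj (u t id) \<circ> u t id = adj id \<circ> id" using iso that M_id unfolding product_system_iso_def by blast
      then show ?thesis by (simp add: V_def adj_id fun_eq_iff)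
    qed
    \<comment> \<open>The residual \<open>\<xi>\<close> is killed by \<open>adj (V t)\<close>. An
      intertwiner \<open>S\<close> with \<open>S \<xi>\<close> nonzero has its adjoint in the
      intertwiner space, so \<open>adj S = V t \<circ> m\<close>; then \<open>S\<close> factors
      through \<open>adj (V t)\<close> and kills \<open>\<xi>\<close>, a contradiction.\<close>
    have coisometry: "V t (adj (V t) y) = y" if t: "0 \<le> t" for t y
    proof (rule ccontr)
      interpret normal_endomorphism M "\<theta>' t"
        using assms(3) t by unfold_locales (auto simp: E0_semigroup_def)
      define \<xi> where "\<xi> = y - V t (adj (V t) y)"
      assume "V t (adj (V t) y) \<noteq> y"
      then have "\<xi> \<noteq> 0" by (simp add: \<xi>_def)
      then obtain S where S: "bounded_op S" "\<And>b. b \<in> N \<Longrightarrow> S \<circ> \<theta>' t b = b \<circ> S" "S \<xi> \<noteq> 0"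
        using exists_intertwiner by metis
      have "\<theta>' t b \<circ> adj S = adj S \<circ> b" if b: "b \<in> N" for b
      proof -
        have "adj (S \<circ> \<theta>' t (adj b)) = adj (adj b \<circ> S)" using S(2)[OF N_adj[OF b]] by simp
        then show ?thesis
          using b S(1) by (simp add: adj_comp theta_adj theta_bounded N_bounded bounded_op_adj adj_adj)
      qed
      then have "adj S \<in> intertwiner_space M \<theta>' t"
        using S(1) by (simp add: intertwiner_space_def BG_def bounded_op_adj)
      then obtain m where m: "m \<in> M" "adj S = V t \<circ> m" using image[OF t] by blast
      have "S = adj m \<circ> adj (V t)"
        using adj_adj[OF S(1)] m Vb[OF t] by (simp add: adj_comp M_bounded)
      moreover have "adj (V t) \<xi> = 0"
        by (simp add: \<xi>_def bounded_opD(5)[OF bounded_op_adj[OF Vb[OF t]]] isometry[OF t])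
      ultimately show False
        using S(3) bounded_opD(3)[OF bounded_op_adj[OF M_bounded[OF m(1)]]] by simp
    qed
    have V: "unitary_op (V t)" if "0 \<le> t" for t
      using that by (simp add: unitary_op_def BG_def Vb fun_eq_iff isometry coisometry)
    have V0: "V 0 = id" using iso M_id by (simp add: product_system_iso_def V_def)
    have V_add: "V (s + t) = V s \<circ> V t" if "0 \<le> s" "0 \<le> t" for s t
    proof -
      \<comment> \<open>Multiplicativity of \<open>u\<close> at the units gives the semigroup law,
        because \<open>\<theta> t\<close> is unital.\<close>
      have "u (s + t) (\<theta> t id \<circ> id) = u s id \<circ> u t id"
        using iso that M_id unfolding product_system_iso_def by blast
      moreover have "\<theta> t id = id" using assms(2) that by (simp add: E0_semigroup_def star_endomorphism_def)
      ultimately show ?thesis by (simp add: V_def)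
    qed
    define U where "U = extend_adj V"
    have U: "unitary_op (U t)" for t
      using V[of t] unitary_op_adj[OF V[of "- t"]] by (simp add: U_def extend_adj_def)
    have U_add: "U (s + t) = U s \<circ> U t" for s t
      unfolding U_def using V V_add by (rule extend_adj_add)
    have U0: "U 0 = id" by (simp add: U_def extend_adj_def V0)
    define \<alpha> where "\<alpha> t A = U t \<circ> A \<circ> adj (U t)" for t and A :: "'a \<Rightarrow> 'a"
    have "pairing M \<theta> \<theta>' \<alpha>"
      unfolding pairing_def
    proof (intro conjI allI ballI impI)
      fix t show "star_automorphism (\<alpha> t)"
        by (rule star_automorphism_conjugation[OF U[of t]]) (simp add: \<alpha>_def)
    next
      fix A show "\<alpha> 0 A = A" by (simp add: \<alpha>_def U0 adj_id)
    next
      fix s t A show "\<alpha> (s + t) A = \<alpha> s (\<alpha> t A)"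
        by (simp add: \<alpha>_def U_add adj_comp unitary_opD(1)[OF U] o_assoc)
    next
      fix t :: real and b assume t: "0 \<le> t" and b: "b \<in> M"
      \<comment> \<open>At negative times the conjugation starts with \<open>adj (V t)\<close>, so
        left linearity of \<open>u t\<close>, in the form \<open>V_M\<close>, recovers
        \<open>\<theta> t\<close>; at positive times \<open>V_N\<close> recovers
        \<open>\<theta>' t\<close>.\<close>
      have "\<alpha> (- t) b = adj (V t) \<circ> b \<circ> V t"
        using t by (simp add: \<alpha>_def U_def extend_adj_minus[of V, OF V0] adj_adj[OF Vb])
      also have "\<dots> = \<theta> t b" using t b by (simp add: fun_eq_iff isometry flip: V_M)
      finally show "\<alpha> (- t) b = \<theta> t b" .
    next
      fix t :: real and b assume t: "0 \<le> t" and b: "b \<in> N"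
      have "\<alpha> t b = V t \<circ> b \<circ> adj (V t)" using t by (simp add: \<alpha>_def U_def extend_adj_def)
      also have "\<dots> = \<theta>' t b" using t b by (simp add: fun_eq_iff coisometry flip: V_N)
      finally show "\<alpha> t b = \<theta>' t b" .
    qed
    moreover have "inner_pairing \<alpha>"
      unfolding inner_pairing_def using U U0 U_add by (intro exI[of _ U]) (simp add: \<alpha>_def)
    ultimately show "\<exists>\<alpha>. pairing M \<theta> \<theta>' \<alpha> \<and> inner_pairing \<alpha>" by blast
  }
qed

end
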